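(* Let $n\ge 1$ be an integer and let $\alpha>-1$. The $\beta$-(semi)norm of the Bergman projection $P_\alpha:L^\infty(\mathbb{B})\to\mathcal{B}$ is $$\|P_\alpha\|_\beta = C_{\alpha,n} := \frac{\Gamma(2+n+\alpha)}{\Gamma^2\left((2+n+\alpha)/2\right)},$$ where $\Gamma$ is Euler's Gamma function.
   Context: Here $\langle z,w\rangle=z_1\overline{w}_1+\dots+z_n\overline{w}_n$ is the inner product on $\mathbb{C}^n$, $|z|=\langle z,z\rangle^{1/2}$, and $\mathbb{B}=\{z\in\mathbb{C}^n:|z|<1\}$. $dv$ is the volume (Lebesgue) measure normalized so that $v(\mathbb{B})=1$, and for $\alpha>-1$, $dv_\alpha(z)=c_\alpha(1-|z|^2)^\alpha dv(z)$ with $c_\alpha=\binom{n+\alpha}{n}=\frac{\Gamma(n+\alpha+1)}{\Gamma(n+1)\Gamma(\alpha+1)}$, so that $v_\alpha(\mathbb{B})=1$. $L^\infty(\mathbb{B})$ is the space of essentially bounded complex-valued measurable functions on $\mathbb{B}$, with norm $\|\cdot\|_\infty$. For a holomorphic function $f$ on $\mathbb{B}$, $\nabla f(z)=\left(\frac{\partial f}{\partial z_1}(z),\dots,\frac{\partial f}{\partial z_n}(z)\right)$ is the complex gradient and $\|f\|_\beta=\sup_{z\in\mathbb{B}}(1-|z|^2)|\nabla f(z)|$. The Bloch space $\mathcal{B}$ consists of all holomorphic $f$ on $\mathbb{B}$ with $\|f\|_\beta<\infty$. The Bergman projection is $$P_\alpha g(z)=\int_{\mathbb{B}}\frac{g(w)}{(1-\langle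 z,w\rangle)^{n+1+\alpha}}\,dv_\alpha(w),\quad z\in\mathbb{B},\ g\in L^\infty(\mathbb{B}),$$ and $\|P_\alpha\|_\beta=\sup\{\|P_\alpha g\|_\beta: g\in L^\infty(\mathbb{B}),\ \|g\|_\infty\le1\}$. *)

theory Defs
  imports "HOL-Analysis.Analysis" "HOL-Probability.Essential_Supremum"
begin

abbreviation unit_ball :: "(complex ^ 'n::finite) set"
  where "unit_ball \<equiv> ball 0 1"

text \<open>The Hermitian product; the library inner product on \<^typ>\<open>complex ^ 'n\<close> is its real part.
  The norm of \<^typ>\<open>complex ^ 'n\<close> is already the Euclidean one (see \<open>cinner_self\<close> below).\<close>

definition cinner :: "complex ^ 'n::finite \<Rightarrow> complex ^ 'n \<Rightarrow> complex"
  where "cinner z w = (\<Sum>i\<in>UNIV. z $ i * cnj (w $ i))"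

lemma cinner_self: "cinner z z = complex_of_real ((norm z)\<^sup>2)"
  by (simp add: cinner_def norm_vec_def L2_set_def sum_nonneg complex_norm_square flip: of_real_power)

definition ball_measure :: "(complex ^ 'n::finite) measure"
  where "ball_measure = uniform_measure (lebesgue_on unit_ball) unit_ball"

definition ball_const :: "nat \<Rightarrow> real \<Rightarrow> real"
  where "ball_const n \<alpha> = Gamma (real n + \<alpha> + 1) / (Gamma (real n + 1) * Gamma (\<alpha> + 1))"

definition weighted_ball_measure :: "real \<Rightarrow> (complex ^ 'n::finite) measure"
  where "weighted_ball_measure \<alpha> =
    density ball_measure (\<lambda>z. ennreal (ball_const CARD('n) \<alpha> * (1 - (norm z)\<^sup>2) powr \<alpha>))"

text \<open>Functions on the unit ball are represented by total functions on \<^typ>\<open>complex ^ 'n\<close>; none of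
  the notions below depends on the values outside the ball. Elements of \<open>L\<^sup>\<infinity>\<close> are represented
  by functions rather than by classes of almost everywhere equal functions.\<close>

definition Linf_norm :: "(complex ^ 'n::finite \<Rightarrow> complex) \<Rightarrow> ereal"
  where "Linf_norm g = esssup ball_measure (\<lambda>z. ereal (norm (g z)))"

definition Linf :: "(complex ^ 'n::finite \<Rightarrow> complex) set"
  where "Linf = {g \<in> borel_measurable ball_measure. Linf_norm g < \<infinity>}"

text \<open>Holomorphy in several variables: on an open set, Frechet differentiability with
  a complex-linear derivative at every point.\<close>

definition cn_holomorphic_on :: "(complex ^ 'n::finite \<Rightarrow> complex) \<Rightarrow> (complex ^ 'n) set \<Rightarrow> bool"
  where "cn_holomorphic_on f S \<longleftrightarrow>
    (\<forall>z\<in>S. \<exists>f'. (f has_derivative f') (at z) \<and> (\<forall>c v. f' (c *s v) = c * f' v))"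

text \<open>\<open>axis i \<zeta>\<close> is \<open>\<zeta>\<close> times the \<open>i\<close>-th unit vector, so
  the components are the complex partial derivatives.\<close>

definition cgrad :: "(complex ^ 'n::finite \<Rightarrow> complex) \<Rightarrow> complex ^ 'n \<Rightarrow> complex ^ 'n"
  where "cgrad f z = (\<chi> i. deriv (\<lambda>\<zeta>. f (z + axis i \<zeta>)) 0)"

text \<open>Suprema are taken in the extended reals, so that infinite values are not lost.\<close>

definition bloch_seminorm :: "(complex ^ 'n::finite \<Rightarrow> complex) \<Rightarrow> ereal"
  where "bloch_seminorm f = (SUP z\<in>unit_ball. ereal ((1 - (norm z)\<^sup>2) * norm (cgrad f z)))"

definition bloch_space :: "(complex ^ 'n::finite \<Rightarrow> complex) set"
  where "bloch_space = {f. cn_holomorphic_on f unit_ball \<and> bloch_seminorm f < \<infinity>}"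

text \<open>The complex power is the principal branch; the real part of \<open>1 - cinner z w\<close> is positive for
  \<open>z\<close> and \<open>w\<close> in the unit ball.\<close>

definition bergman_projection ::
    "real \<Rightarrow> (complex ^ 'n::finite \<Rightarrow> complex) \<Rightarrow> complex ^ 'n \<Rightarrow> complex"
  where "bergman_projection \<alpha> g z =
    (\<integral>w. g w / (1 - cinner z w) powr complex_of_real (real CARD('n) + 1 + \<alpha>)
      \<partial>weighted_ball_measure \<alpha>)"

definition bloch_op_seminorm ::
    "((complex ^ 'n::finite \<Rightarrow> complex) \<Rightarrow> complex ^ 'n \<Rightarrow> complex) \<Rightarrow> ereal"
  where "bloch_op_seminorm T = (SUP g\<in>{g \<in> Linf. Linf_norm g \<le> 1}. bloch_seminorm (T g))"

end

theory Submission imports Defs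
begin

text \<open>
  Put \<open>p = n + 1 + \<alpha>\<close>. Differentiating under the integral, \<open>\<nabla>(P\<^sub>\<alpha> g)(z)\<close> is \<open>p\<close> times the integral of
  \<open>g(w) cnj(w) (1 - \<langle>z,w\<rangle>) powr (-p-1)\<close>. For \<open>\<bar>g\<bar> \<le> 1\<close> the bound \<open>\<bar>w\<bar> < 1\<close> gives
  \<open>\<bar>\<nabla>(P\<^sub>\<alpha> g)(z)\<bar> \<le> p F(p + 1)\<close> with \<open>F q = \<integral> \<bar>1 - \<langle>z,w\<rangle>\<bar> powr (-q) dv\<^sub>\<alpha>\<close>. By the binomial series and
  the orthogonality of the powers \<open>\<langle>z,w\<rangle>\<^sup>k\<close>, \<open>F q\<close> is the power series in \<open>x = \<bar>z\<bar>\<^sup>2\<close> with coefficients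
  \<open>(q/2)\<^sub>k\<^sup>2 / (k! (p)\<^sub>k)\<close>. For \<open>q = p + 1\<close> they increase to \<open>L = \<Gamma>(p) / \<Gamma>((p+1)/2)\<^sup>2\<close>, so
  \<open>(1 - x) p F(p + 1) \<le> p L\<close>, which is the claimed constant. Conversely, for \<open>z\<close> on the \<open>i\<close>-th axis, choose
  \<open>g\<close> so that the \<open>i\<close>-th partial derivative integrates the absolute value of its kernel; as
  \<open>1 - \<bar>w\<^sub>i\<bar> \<le> \<bar>1 - \<langle>z,w\<rangle>\<bar>\<close>, that derivative is at least \<open>p (F(p + 1) - F p)\<close>. The coefficients of \<open>F p\<close>
  tend to 0, so by an Abelian theorem \<open>(1 - x) p (F(p + 1) - F p)\<close> tends to \<open>p L\<close> as \<open>x\<close> tends to 1.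

  The moments of \<open>\<langle>z,w\<rangle>\<close> come from those of the Gaussian, whose exponential moments are computed
  by a translation, so no coordinates on the sphere are needed.
\<close>

section \<open>Lebesgue measure and Gaussian moments\<close>

lemma nn_integral_lborel_scaleR:
  fixes f :: "'a::euclidean_space \<Rightarrow> ennreal"
  assumes [measurable]: "f \<in> borel_measurable borel" and c: "c \<noteq> 0"
  shows "(\<integral>\<^sup>+x. f x \<partial>lborel) = ennreal (\<bar>c\<bar> ^ DIM('a)) * (\<integral>\<^sup>+x. f (c *\<^sub>R x) \<partial>lborel)"
  by (subst lborel_affine[of c 0])
     (use c in \<open>simp_all add: nn_integral_density nn_integral_distr nn_integral_cmult ennreal_power\<close>)

text \<open>Since \<open>T\<close> is additive and onto, the image measure is translation invariant;
  since \<open>T\<close> preserves norms, it agrees with \<open>lborel\<close> on centred balls.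
  Sigma-finite translation invariant measures are proportional, so the two coincide.\<close>

lemma distr_lborel_orthogonal_transformation:
  fixes T :: "'a::euclidean_space \<Rightarrow> 'a"
  assumes T: "orthogonal_transformation T"
  shows "distr lborel borel T = lborel"
proof (rule measure_eqI)
  let ?M = "distr lborel borel T"
  let ?B = "ball 0 1 :: 'a set"
  have [measurable]: "?B \<in> sets borel" by simp
  have lin: "linear T" using T by (rule orthogonal_transformation_linear)
  have [measurable]: "T \<in> borel_measurable borel"
    using lin by (intro borel_measurable_continuous_onI linear_continuous_on linear_conv_bounded_linear[THEN iffD1])
  have bij: "bij T" using T by (rule orthogonal_transformation_bij)
  show "sets ?M = sets lborel" by simp
  \<comment> \<open>Translating by \<open>y\<close> after \<open>T\<close> amounts to translating by
    \<open>inv T y\<close> before \<open>T\<close>.\<close>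
  have shift: "(\<integral>\<^sup>+x. f (x + y) \<partial>?M) = (\<integral>\<^sup>+x. f x \<partial>?M)"
    if [measurable]: "f \<in> borel_measurable borel" for f :: "'a \<Rightarrow> ennreal" and y
  proof -
    have "(\<integral>\<^sup>+x. f (x + y) \<partial>?M) = (\<integral>\<^sup>+x. f (T x + y) \<partial>lborel)"
      by (simp add: nn_integral_distr)
    also have "\<dots> = (\<integral>\<^sup>+x. f (T (inv T y + x)) \<partial>lborel)"
      using bij lin by (simp add: linear_add bij_is_surj surj_f_inv_f add.commute)
    also have "\<dots> = (\<integral>\<^sup>+x. f (T x) \<partial>distr lborel borel ((+) (inv T y)))"
      by (simp add: nn_integral_distr)
    also have "\<dots> = (\<integral>\<^sup>+x. f x \<partial>?M)"
      by (simp add: nn_integral_distr lborel_distr_plus)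
    finally show ?thesis .
  qed
  \<comment> \<open>The Fubini computation below ends with \<open>A\<close> evaluated at
    \<open>x - y\<close> and integrated in \<open>y\<close>, which calls for invariance under
    reflection.\<close>
  have neg: "emeasure lborel (uminus -` A) = emeasure lborel A" if [measurable]: "A \<in> sets borel" for A :: "'a set"
  proof -
    have [measurable]: "uminus -` A \<in> sets borel"
      using measurable_sets[of uminus borel borel A] by simp
    have "emeasure lborel A = (\<integral>\<^sup>+x. indicator A ((-1) *\<^sub>R x) \<partial>lborel)"
      using nn_integral_lborel_scaleR[of "indicator A" "-1"] by simp
    also have "\<dots> = (\<integral>\<^sup>+x. indicator (uminus -` A) x \<partial>lborel)"
      by (intro nn_integral_cong) (auto simp: indicator_def)
    also have "\<dots> = emeasure lborel (uminus -` A)"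
      by simp
    finally show ?thesis by simp
  qed
  have MB: "emeasure ?M ?B = emeasure lborel ?B"
  proof -
    have "T -` ?B = ?B" using T by (auto simp: orthogonal_transformation_norm)
    then show ?thesis by (simp add: emeasure_distr)
  qed
  have pos: "emeasure lborel ?B \<noteq> 0" "emeasure lborel ?B \<noteq> \<infinity>"
  proof -
    show "emeasure lborel ?B \<noteq> 0"
      using open_not_negligible[of ?B] by (auto simp: negligible_iff_null_sets null_sets_def)
    show "emeasure lborel ?B \<noteq> \<infinity>"
      using emeasure_lborel_ball_finite[of "0::'a" 1] by simp
  qed
  have sf: "sigma_finite_measure ?M"
  proof 
    let ?A = "range (\<lambda>n::nat. ball (0::'a) n)"
    have "(\<Union>n::nat. ball (0::'a) n) = UNIV"
      using reals_Archimedean2 by (auto simp: )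
    moreover have "emeasure ?M (ball 0 r) \<noteq> \<infinity>" for r
    proof -
      have "T -` ball 0 r = ball 0 r" using T by (auto simp: orthogonal_transformation_norm)
      then show ?thesis
        using emeasure_lborel_ball_finite[of "0::'a" r] by (simp add: emeasure_distr)
    qed
    ultimately show "\<exists>A. countable A \<and> A \<subseteq> sets ?M \<and> \<Union>A = space ?M \<and> (\<forall>a\<in>A. emeasure ?M a \<noteq> \<infinity>)"
      by (intro exI[of _ ?A]) auto
  qed
  interpret pair_sigma_finite ?M lborel
    using sf by (auto simp: pair_sigma_finite_def sigma_finite_lborel)
  fix A assume "A \<in> sets ?M"
  then have [measurable]: "A \<in> sets borel" by simp
  text \<open>The Fubini argument for uniqueness of translation invariant measures; the unit ball, which
    \<open>T\<close> preserves, fixes the constant.\<close>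
  have "emeasure ?M A * emeasure lborel ?B = (\<integral>\<^sup>+x. \<integral>\<^sup>+y. indicator A x * indicator ?B y \<partial>lborel \<partial>?M)"
    by (subst nn_integral_cmult) (auto simp: nn_integral_multc)
  also have "\<dots> = (\<integral>\<^sup>+x. \<integral>\<^sup>+y. indicator A x * indicator ?B (x + y) \<partial>lborel \<partial>?M)"
  proof (rule nn_integral_cong)
    fix x
    have "(\<integral>\<^sup>+y. indicator A x * indicator ?B y \<partial>lborel) =
        (\<integral>\<^sup>+y. indicator A x * indicator ?B y \<partial>distr lborel borel ((+) x))"
      by (simp add: lborel_distr_plus)
    then show "(\<integral>\<^sup>+y. indicator A x * indicator ?B y \<partial>lborel) =
        (\<integral>\<^sup>+y. indicator A x * indicator ?B (x + y) \<partial>lborel)"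
      by (simp add: nn_integral_distr)
  qed
  also have "\<dots> = (\<integral>\<^sup>+y. \<integral>\<^sup>+x. indicator A x * indicator ?B (x + y) \<partial>?M \<partial>lborel)"
    by (rule Fubini'[symmetric]) measurable
  \<comment> \<open>For fixed \<open>y\<close>, invariance of \<open>?M\<close> under translation
    moves the shift from the ball to \<open>A\<close>.\<close>
  also have "\<dots> = (\<integral>\<^sup>+y. \<integral>\<^sup>+x. indicator A (x - y) * indicator ?B x \<partial>?M \<partial>lborel)"
  proof (rule nn_integral_cong)
    fix y
    show "(\<integral>\<^sup>+x. indicator A x * indicator ?B (x + y) \<partial>?M) = (\<integral>\<^sup>+x. indicator A (x - y) * indicator ?B x \<partial>?M)"
      using shift[of "\<lambda>x. indicator A (x - y) * indicator ?B x" y] by simp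
  qed
  also have "\<dots> = (\<integral>\<^sup>+x. \<integral>\<^sup>+y. indicator A (x - y) * indicator ?B x \<partial>lborel \<partial>?M)"
    by (rule Fubini') measurable
  also have "\<dots> = (\<integral>\<^sup>+x. emeasure lborel A * indicator ?B x \<partial>?M)"
  proof (rule nn_integral_cong)
    fix x
    have "(\<integral>\<^sup>+y. indicator A (x - y) * indicator ?B x \<partial>lborel)
        = (\<integral>\<^sup>+y. indicator A (x - y) \<partial>distr lborel borel ((+) x)) * indicator ?B x"
      by (simp add: lborel_distr_plus nn_integral_multc)
    also have "(\<integral>\<^sup>+y. indicator A (x - y) \<partial>distr lborel borel ((+) x)) = (\<integral>\<^sup>+y. indicator A (- y) \<partial>lborel)"
      by (simp add: nn_integral_distr)
    also have "\<dots> = (\<integral>\<^sup>+y. indicator (uminus -` A) y \<partial>lborel)"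
      by (intro nn_integral_cong) (auto simp: indicator_def)
    also have "\<dots> = emeasure lborel A"
      using measurable_sets[of uminus borel borel A] by (subst nn_integral_indicator) (auto simp: neg)
    finally show "(\<integral>\<^sup>+y. indicator A (x - y) * indicator ?B x \<partial>lborel) = emeasure lborel A * indicator ?B x" .
  qed
  also have "\<dots> = emeasure lborel A * emeasure ?M ?B"
    by (simp add: nn_integral_cmult)
  finally have "emeasure lborel ?B * emeasure ?M A = emeasure lborel ?B * emeasure lborel A"
    by (simp add: MB mult.commute)
  then show "emeasure ?M A = emeasure lborel A"
    using pos by (simp add: ennreal_mult_cancel_left)
qed

section \<open>Gamma integrals and Gaussian moments of real linear functionals\<close>

lemma nn_integral_Gamma:
  fixes a :: real
  assumes "a > 0"
  shows "(\<integral>\<^sup>+t. ennreal (t powr (a - 1) * exp (- t)) * indicator {0..} t \<partial>lborel) = ennreal (Gamma a)"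
  using nn_integral_has_integral_lebesgue'[OF _ Gamma_integral_real[OF assms]]
  by (simp add: exp_minus divide_inverse)

text \<open>Completing the square: translation by z/2 turns the exponent z.x - |x|^2 into |z|^2/4 -
  |x|^2.\<close>

lemma nn_integral_gaussian_exp_inner:
  fixes z :: "'a::euclidean_space"
  shows "(\<integral>\<^sup>+x. ennreal (exp (z \<bullet> x) * exp (- (norm x)\<^sup>2)) \<partial>lborel) =
    ennreal (exp ((norm z)\<^sup>2 / 4)) * (\<integral>\<^sup>+x. ennreal (exp (- (norm (x::'a))\<^sup>2)) \<partial>lborel)"
proof -
  have "(\<integral>\<^sup>+x. ennreal (exp (z \<bullet> x) * exp (- (norm x)\<^sup>2)) \<partial>lborel) =
      (\<integral>\<^sup>+x. ennreal (exp (z \<bullet> x) * exp (- (norm x)\<^sup>2)) \<partial>distr lborel borel ((+) ((1/2) *\<^sub>R z)))"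
    by (simp add: lborel_distr_plus)
  also have "\<dots> = (\<integral>\<^sup>+x. ennreal (exp ((norm z)\<^sup>2 / 4)) * ennreal (exp (- (norm (x::'a))\<^sup>2)) \<partial>lborel)"
    unfolding power2_norm_eq_inner
    by (subst nn_integral_distr)
       (auto simp: inner_add inner_commute algebra_simps simp flip: exp_add ennreal_mult')
  also have "\<dots> = ennreal (exp ((norm z)\<^sup>2 / 4)) * (\<integral>\<^sup>+x. ennreal (exp (- (norm (x::'a))\<^sup>2)) \<partial>lborel)"
    by (simp add: nn_integral_cmult)
  finally show ?thesis .
qed

lemma cosh_sums_even: "(\<lambda>k. x ^ (2 * k) / fact (2 * k)) sums cosh (x::real)"
proof -
  have "strict_mono (\<lambda>k::nat. 2 * k)" by (simp add: strict_mono_def)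
  moreover have "even n \<Longrightarrow> n \<in> range (\<lambda>k::nat. 2 * k)" for n by (auto elim: evenE)
  ultimately have "(\<lambda>k. (\<lambda>n. if even n then x ^ n /\<^sub>R fact n else 0) (2 * k)) sums cosh x
      \<longleftrightarrow> (\<lambda>n. if even n then x ^ n /\<^sub>R fact n else 0) sums cosh x"
    by (intro sums_mono_reindex) auto
  then show ?thesis
    using cosh_converges[of x] by (simp add: divide_inverse mult.commute)
qed

text \<open>If \<open>m\<close> is the first index where the coefficients differ, the difference of
  the series divided by \<open>u ^ m\<close> tends to \<open>d m\<close> as \<open>u\<close>
  decreases to 0, yet it vanishes for \<open>u > 0\<close>. The half line suffices for the
  application, where \<open>u\<close> is the square of a real parameter.\<close>

lemma powser_eq_nonneg_imp_coeff_eq: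
  fixes a b :: "nat \<Rightarrow> real"
  assumes a: "\<And>u. u \<ge> 0 \<Longrightarrow> (\<lambda>k. a k * u ^ k) sums f u"
    and b: "\<And>u. u \<ge> 0 \<Longrightarrow> (\<lambda>k. b k * u ^ k) sums f u"
  shows "a = b"
proof (rule ccontr)
  assume "a \<noteq> b"
  define d where "d k = a k - b k" for k
  have d: "(\<lambda>k. d k * u ^ k) sums 0" if "u \<ge> 0" for u
    using sums_diff[OF a[OF that] b[OF that]] by (simp add: d_def algebra_simps)
  have "\<exists>m. d m \<noteq> 0"
    using \<open>a \<noteq> b\<close> by (auto simp: d_def)
  then obtain m where m: "d m \<noteq> 0" and lt: "\<And>k. k < m \<Longrightarrow> d k = 0"
    using exists_least_iff[of "\<lambda>m. d m \<noteq> 0"] by blast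
  have shifted: "(\<lambda>k. d (k + m) * u ^ k) sums 0" if "u > 0" for u
  proof -
    have "(\<lambda>k. d (k + m) * u ^ (k + m)) sums 0"
      using d[of u] that lt sums_iff_shift[of "\<lambda>k. d k * u ^ k" m 0] by simp
    then have "(\<lambda>k. d (k + m) * u ^ (k + m) / u ^ m) sums (0 / u ^ m)"
      by (rule sums_divide)
    then show ?thesis using that by (simp add: power_add)
  qed
  \<comment> \<open>Convergence at the positive point \<open>\<bar>u\<bar> + 1\<close> yields
    convergence at \<open>u\<close> of either sign, so the two-sided limit at 0 is
    available.\<close>
  have "(\<lambda>k. d (k + m) * u ^ k) sums (\<Sum>k. d (k + m) * u ^ k)" for u
  proof -
    have "summable (\<lambda>k. d (k + m) * (\<bar>u\<bar> + 1) ^ k)"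
      using shifted[of "\<bar>u\<bar> + 1"] by (auto simp: summable_def add_nonneg_pos)
    then have "summable (\<lambda>k. d (k + m) * u ^ k)"
      by (rule powser_inside) auto
    then show ?thesis by (simp add: summable_sums)
  qed
  then have "((\<lambda>u. \<Sum>k. d (k + m) * u ^ k) \<longlongrightarrow> d (0 + m)) (at 0)"
    by (intro powser_limit_0[of 1]) auto
  then have "((\<lambda>u. \<Sum>k. d (k + m) * u ^ k) \<longlongrightarrow> d m) (at_right 0)"
    by (simp add: filterlim_at_split)
  moreover have "\<forall>\<^sub>F u in at_right 0. (\<Sum>k. d (k + m) * u ^ k) = 0"
    using shifted by (auto simp: eventually_at_filter sums_iff)
  ultimately have "((\<lambda>_. 0) \<longlongrightarrow> d m) (at_right (0::real))"
    using tendsto_cong by fastforce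
  with m show False
    using tendsto_unique[of "at_right (0::real)" "\<lambda>_. 0" 0 "d m"] by auto
qed

text \<open>The coefficients of \<open>t\<^sup>2\<^sup>k\<close> are compared in the integral of \<open>cosh (t (z \<bullet> x)) exp (- \<bar>x\<bar>\<^sup>2)\<close>;
  nonnegativity makes the exchange of sum and integral free.\<close>

lemma nn_integral_gaussian_even_moment:
  fixes z :: "'a::euclidean_space"
  assumes fin: "(\<integral>\<^sup>+x. ennreal (exp (- (norm (x::'a))\<^sup>2)) \<partial>lborel) = ennreal G" and "G \<ge> 0"
  shows "(\<integral>\<^sup>+x. ennreal ((z \<bullet> x) ^ (2 * k) * exp (- (norm x)\<^sup>2)) \<partial>lborel) =
    ennreal (G * fact (2 * k) / (4 ^ k * fact k) * norm z ^ (2 * k))"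
proof -
  define M where "M k = (\<integral>\<^sup>+x. ennreal ((z \<bullet> x) ^ (2 * k) * exp (- (norm x)\<^sup>2)) \<partial>lborel)" for k
  \<comment> \<open>The generating function of the even moments in \<open>u = t\<^sup>2\<close>. It
    is formed in \<open>ennreal\<close>, before the moments are known to be finite.\<close>
  have gen: "(\<lambda>k. ennreal (u ^ k / fact (2 * k)) * M k) sums ennreal (exp (u * (norm z)\<^sup>2 / 4) * G)"
    if "u \<ge> 0" for u
  proof -
    define t where "t = sqrt u"
    have t: "t ^ 2 = u" using that by (simp add: t_def)
    have "(\<Sum>k. ennreal (u ^ k / fact (2 * k)) * M k) =
        (\<Sum>k. \<integral>\<^sup>+x. ennreal (u ^ k / fact (2 * k)) * ennreal ((z \<bullet> x) ^ (2 * k) * exp (- (norm x)\<^sup>2)) \<partial>lborel)"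
      unfolding M_def by (simp add: nn_integral_cmult)
    also have "\<dots> = (\<integral>\<^sup>+x. (\<Sum>k. ennreal (u ^ k / fact (2 * k)) * ennreal ((z \<bullet> x) ^ (2 * k) * exp (- (norm x)\<^sup>2))) \<partial>lborel)"
      by (rule nn_integral_suminf[symmetric]) measurable
    also have "\<dots> = (\<integral>\<^sup>+x. ennreal (cosh (t * (z \<bullet> x)) * exp (- (norm x)\<^sup>2)) \<partial>lborel)"
    proof (rule nn_integral_cong)
      fix x
      have "(\<lambda>k. (t * (z \<bullet> x)) ^ (2 * k) / fact (2 * k) * exp (- (norm x)\<^sup>2)) sums (cosh (t * (z \<bullet> x)) * exp (- (norm x)\<^sup>2))"
        by (intro sums_mult2 cosh_sums_even)
      also have "(\<lambda>k. (t * (z \<bullet> x)) ^ (2 * k) / fact (2 * k) * exp (- (norm x)\<^sup>2)) =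
          (\<lambda>k. (u ^ k / fact (2 * k)) * ((z \<bullet> x) ^ (2 * k) * exp (- (norm x)\<^sup>2)))"
        by (simp add: power_mult_distrib power_mult t power_commutes[symmetric] mult.assoc mult.left_commute)
      finally have "(\<lambda>k. ennreal ((u ^ k / fact (2 * k)) * ((z \<bullet> x) ^ (2 * k) * exp (- (norm x)\<^sup>2)))) sums
          ennreal (cosh (t * (z \<bullet> x)) * exp (- (norm x)\<^sup>2))"
        using that by (subst sums_ennreal) auto
      then show "(\<Sum>k. ennreal (u ^ k / fact (2 * k)) * ennreal ((z \<bullet> x) ^ (2 * k) * exp (- (norm x)\<^sup>2))) =
          ennreal (cosh (t * (z \<bullet> x)) * exp (- (norm x)\<^sup>2))"
        using that by (simp add: sums_iff flip: ennreal_mult')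
    qed
    \<comment> \<open>Each half of cosh is a Gaussian exponential moment, and both are equal because
      \<open>t *\<^sub>R z\<close> and its negative have the same norm.\<close>
    also have "\<dots> = (\<integral>\<^sup>+x. ennreal (1 / 2) * (ennreal (exp ((t *\<^sub>R z) \<bullet> x) * exp (- (norm x)\<^sup>2))
        + ennreal (exp (((-t) *\<^sub>R z) \<bullet> x) * exp (- (norm x)\<^sup>2))) \<partial>lborel)"
      by (intro nn_integral_cong, subst ennreal_plus[symmetric], simp, simp, subst ennreal_mult'[symmetric])
         (simp_all add: cosh_def algebra_simps)
    also have "\<dots> = ennreal (1 / 2) * (ennreal (exp (u * (norm z)\<^sup>2 / 4)) * ennreal G + ennreal (exp (u * (norm z)\<^sup>2 / 4)) * ennreal G)"
      by (subst nn_integral_cmult, measurable, subst nn_integral_add, measurable,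
          unfold nn_integral_gaussian_exp_inner fin) (simp add: t power_mult_distrib)
    also have "\<dots> = ennreal (exp (u * (norm z)\<^sup>2 / 4) * G)"
    proof -
      let ?E = "exp (u * (norm z)\<^sup>2 / 4) * G"
      have "ennreal (1 / 2) * (ennreal ?E + ennreal ?E) = ennreal (1 / 2) * ennreal (?E + ?E)"
        using \<open>G \<ge> 0\<close> by (subst ennreal_plus) auto
      also have "\<dots> = ennreal (1 / 2 * (?E + ?E))"
        by (rule ennreal_mult'[symmetric]) simp
      finally show ?thesis
        using \<open>G \<ge> 0\<close> by (subst (1 2) ennreal_mult'[symmetric]) auto
    qed
    finally show ?thesis by (simp add: sums_iff)
  qed
  define m where "m k = enn2real (M k)" for k
  \<comment> \<open>Finiteness of the generating function at \<open>u = 1\<close> bounds every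
    single moment.\<close>
  have fin: "M k = ennreal (m k)" and nn: "m k \<ge> 0" for k
  proof -
    have "ennreal (1 ^ k / fact (2 * k)) * M k \<le> ennreal (exp (1 * (norm z)\<^sup>2 / 4) * G)"
      using gen[of 1] sum_le_suminf[of "\<lambda>k. ennreal (1 ^ k / fact (2 * k)) * M k" "{k}"]
      by (auto simp: sums_iff)
    then have "M k \<noteq> \<infinity>"
      by (intro notI) (simp add: ennreal_mult_top top_unique)
    then show "M k = ennreal (m k)" "m k \<ge> 0" using ennreal_enn2real[of "M k"] by (simp_all add: m_def top.not_eq_extremum)
  qed
  have "(\<lambda>k. m k / fact (2 * k)) = (\<lambda>k. G * ((norm z)\<^sup>2 / 4) ^ k / fact k)"
  proof (rule powser_eq_nonneg_imp_coeff_eq)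
    fix u :: real assume u: "u \<ge> 0"
    have "(\<lambda>k. ennreal (m k / fact (2 * k) * u ^ k)) sums ennreal (exp (u * (norm z)\<^sup>2 / 4) * G)"
    proof -
      have "ennreal (u ^ k / fact (2 * k)) * M k = ennreal (m k / fact (2 * k) * u ^ k)" for k
        unfolding fin using u nn by (subst ennreal_mult'[symmetric]) (auto simp: mult.commute)
      with gen[OF u] show ?thesis by simp
    qed
    then show "(\<lambda>k. m k / fact (2 * k) * u ^ k) sums (exp (u * (norm z)\<^sup>2 / 4) * G)"
      using u nn \<open>G \<ge> 0\<close> by (subst (asm) sums_ennreal) auto
    have "(\<lambda>k. G * ((u * (norm z)\<^sup>2 / 4) ^ k /\<^sub>R fact k)) sums (G * exp (u * (norm z)\<^sup>2 / 4))"
      by (intro sums_mult exp_converges)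
    moreover have "G * ((u * (norm z)\<^sup>2 / 4) ^ k /\<^sub>R fact k) = G * ((norm z)\<^sup>2 / 4) ^ k / fact k * u ^ k" for k
    proof -
      have eq: "(u * (norm z)\<^sup>2 / 4) ^ k = ((norm z)\<^sup>2 / 4) ^ k * u ^ k"
        by (simp add: mult.commute flip: power_mult_distrib)
      show ?thesis unfolding eq real_scaleR_def by (simp only: divide_inverse mult_ac)
    qed
    ultimately show "(\<lambda>k. G * ((norm z)\<^sup>2 / 4) ^ k / fact k * u ^ k) sums (exp (u * (norm z)\<^sup>2 / 4) * G)"
      by (subst (2) mult.commute) simp
  qed
  then have "m k / fact (2 * k) = G * ((norm z)\<^sup>2 / 4) ^ k / fact k"
    by (simp add: fun_eq_iff)
  then have "m k = fact (2 * k) * (G * ((norm z)\<^sup>2 / 4) ^ k / fact k)"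
    by (simp add: eq_divide_eq divide_eq_eq mult.commute)
  also have "((norm z)\<^sup>2 / 4) ^ k = norm z ^ (2 * k) / 4 ^ k"
    by (simp only: power_divide power_mult)
  finally have "m k = G * fact (2 * k) / (4 ^ k * fact k) * norm z ^ (2 * k)"
    by (simp add: mult_ac)
  then show ?thesis using fin[of k] by (simp add: M_def)
qed

text \<open>Both sides equal the integral over \<open>t > 0\<close> and \<open>\<bar>x\<bar>\<^sup>2 < t\<close> of \<open>exp (- t) h(x) (t - \<bar>x\<bar>\<^sup>2) powr \<alpha>\<close>:
  for fixed \<open>t\<close> dilate \<open>x\<close> by \<open>sqrt t\<close>, for fixed \<open>x\<close> translate \<open>t\<close> by \<open>\<bar>x\<bar>\<^sup>2\<close>.\<close>

lemma nn_integral_ball_homogeneous: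
  fixes h :: "'a::euclidean_space \<Rightarrow> real"
  assumes [measurable]: "h \<in> borel_measurable borel" and nn: "\<And>x. h x \<ge> 0"
    and hom: "\<And>c x. c > 0 \<Longrightarrow> h (c *\<^sub>R x) = c ^ (2 * k) * h x"
    and \<alpha>: "\<alpha> > -1"
  shows "ennreal (Gamma (DIM('a) / 2 + k + \<alpha> + 1)) *
      (\<integral>\<^sup>+x. ennreal (h x * (1 - (norm x)\<^sup>2) powr \<alpha>) * indicator (ball 0 1) x \<partial>lborel) =
    ennreal (Gamma (\<alpha> + 1)) * (\<integral>\<^sup>+x. ennreal (h x * exp (- (norm x)\<^sup>2)) \<partial>lborel)"
proof -
  \<comment> \<open>The common integrand of the double integral; the indicator keeps the region
    |x|^2 \<le> t, where the base of the power is nonnegative.\<close>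
  define \<Phi> where "\<Phi> t x = ennreal (exp (-t) * h x * (t - (norm x)\<^sup>2) powr \<alpha>) * indicator {0..} (t - (norm x)\<^sup>2)"
    for t and x :: 'a
  define A where "A = (\<integral>\<^sup>+x. ennreal (h x * (1 - (norm x)\<^sup>2) powr \<alpha>) * indicator (ball 0 1) x \<partial>lborel)"
  have [measurable]: "case_prod \<Phi> \<in> borel_measurable (borel \<Otimes>\<^sub>M borel)"
    unfolding \<Phi>_def split_beta' by measurable
  have inner_t: "(\<integral>\<^sup>+t. \<Phi> t x * indicator {0..} t \<partial>lborel) = ennreal (h x * exp (- (norm x)\<^sup>2)) * ennreal (Gamma (\<alpha> + 1))" for x
  proof -
    have "(\<integral>\<^sup>+t. \<Phi> t x * indicator {0..} t \<partial>lborel) = (\<integral>\<^sup>+t. \<Phi> t x \<partial>lborel)"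
      by (intro nn_integral_cong) (auto simp: \<Phi>_def indicator_def intro: order_trans[OF zero_le_power2])
    also have "\<dots> = (\<integral>\<^sup>+t. \<Phi> t x \<partial>distr lborel borel ((+) ((norm x)\<^sup>2)))"
      by (simp add: lborel_distr_plus)
    also have "\<dots> = (\<integral>\<^sup>+t. \<Phi> ((norm x)\<^sup>2 + t) x \<partial>lborel)"
      by (subst nn_integral_distr) measurable
    also have "\<dots> = (\<integral>\<^sup>+t. ennreal (h x * exp (- (norm x)\<^sup>2)) * (ennreal (t powr (\<alpha> + 1 - 1) * exp (-t)) * indicator {0..} t) \<partial>lborel)"
      by (intro nn_integral_cong)
         (auto simp: \<Phi>_def indicator_def exp_add exp_diff exp_minus divide_inverse mult_ac nn simp flip: ennreal_mult')
    also have "\<dots> = ennreal (h x * exp (- (norm x)\<^sup>2)) * ennreal (Gamma (\<alpha> + 1))"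
      using \<alpha> nn_integral_Gamma[of "\<alpha> + 1"] by (subst nn_integral_cmult) auto
    finally show ?thesis .
  qed
  \<comment> \<open>With r = sqrt t, the dilation contributes r to the real dimension d,
    \<open>h\<close> contributes \<open>r ^ (2 * k)\<close> and the weight
    \<open>t powr \<alpha>\<close>. Together they form the power d/2 + k + \<alpha> of t.\<close>
  have inner_x: "(\<integral>\<^sup>+x. \<Phi> t x * indicator {0..} t \<partial>lborel) =
      A * (ennreal (t powr (DIM('a) / 2 + k + \<alpha> + 1 - 1) * exp (-t)) * indicator {0..} t)" for t
  proof (cases "t > 0")
    case False
    \<comment> \<open>For t = 0 only x = 0 lies in the region, and there
      \<open>0 powr \<alpha> = 0\<close>.\<close>
    have "\<Phi> 0 x = 0" for x by (auto simp: \<Phi>_def indicator_def)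
    with False show ?thesis by (cases "t = 0") auto
  next
    case True
    define r where "r = sqrt t"
    have r: "r > 0" "t = r\<^sup>2" using True by (auto simp: r_def)
    have "(\<integral>\<^sup>+x. \<Phi> t x * indicator {0..} t \<partial>lborel) = (\<integral>\<^sup>+x. \<Phi> t x \<partial>lborel)"
      using True by simp
    also have "\<dots> = ennreal (r ^ DIM('a)) * (\<integral>\<^sup>+x. \<Phi> t (r *\<^sub>R x) \<partial>lborel)"
      using r by (subst nn_integral_lborel_scaleR[of _ r]) auto
    also have "(\<integral>\<^sup>+x. \<Phi> t (r *\<^sub>R x) \<partial>lborel) =
      (\<integral>\<^sup>+x. ennreal (exp (-t) * r ^ (2 * k) * t powr \<alpha>) *
        (ennreal (h x * (1 - (norm x)\<^sup>2) powr \<alpha>) * indicator (ball 0 1) x) \<partial>lborel)"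
    proof (rule nn_integral_cong)
      fix x :: 'a
      have e: "t - (norm (r *\<^sub>R x))\<^sup>2 = t * (1 - (norm x)\<^sup>2)"
        using r by (simp add: power_mult_distrib algebra_simps)
      consider "norm x < 1" | "norm x = 1" | "norm x > 1" by linarith
      then show "\<Phi> t (r *\<^sub>R x) = ennreal (exp (-t) * r ^ (2 * k) * t powr \<alpha>) *
        (ennreal (h x * (1 - (norm x)\<^sup>2) powr \<alpha>) * indicator (ball 0 1) x)"
      proof cases
        case 1
        then have "(norm x)\<^sup>2 < 1" by (simp add: power_less_one_iff)
        with 1 True have "\<Phi> t (r *\<^sub>R x) = ennreal (exp (-t) * (r ^ (2 * k) * h x) * (t * (1 - (norm x)\<^sup>2)) powr \<alpha>)"
          unfolding \<Phi>_def e by (simp add: hom r(1) indicator_def)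
        also have "exp (-t) * (r ^ (2 * k) * h x) * (t * (1 - (norm x)\<^sup>2)) powr \<alpha> =
            (exp (-t) * r ^ (2 * k) * t powr \<alpha>) * (h x * (1 - (norm x)\<^sup>2) powr \<alpha>)"
          using True \<open>(norm x)\<^sup>2 < 1\<close> by (simp add: powr_mult)
        finally show ?thesis
          using 1 r by (simp add: indicator_def ennreal_mult')
      next
        case 3
        then have "1 < (norm x)\<^sup>2" by (simp add: one_less_power)
        with 3 True have "t * (1 - (norm x)\<^sup>2) < 0" by (simp add: mult_pos_neg)
        with 3 show ?thesis unfolding \<Phi>_def e by (simp add: indicator_def)
      next
        \<comment> \<open>On the unit sphere the indicator in \<open>\<Phi>\<close> is 1 and that of
          the open ball is 0; both sides vanish because \<open>0 powr \<alpha> = 0\<close>.\<close>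
        case 2
        then show ?thesis unfolding \<Phi>_def e by (simp add: indicator_def)
      qed
    qed
    also have "\<dots> = ennreal (exp (-t) * r ^ (2 * k) * t powr \<alpha>) * A"
    proof -
      have [measurable]: "ball (0::'a) 1 \<in> sets borel" by simp
      show ?thesis unfolding A_def by (subst nn_integral_cmult) measurable
    qed
    also have "ennreal (r ^ DIM('a)) * \<dots> = A * ennreal (r ^ DIM('a) * (exp (-t) * r ^ (2 * k) * t powr \<alpha>))"
      using r by (simp add: ennreal_mult mult_ac)
    also have "r ^ DIM('a) * (exp (-t) * r ^ (2 * k) * t powr \<alpha>) = t powr (DIM('a) / 2 + k + \<alpha> + 1 - 1) * exp (-t)"
    proof -
      have rp: "r ^ m = t powr (real m / 2)" for m
        using True powr_realpow[OF r(1), of m] by (simp add: r_def powr_powr flip: powr_half_sqrt)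
      have "t powr (DIM('a) / 2 + k + \<alpha> + 1 - 1) = t powr (DIM('a) / 2) * t powr k * t powr \<alpha>"
        by (simp add: powr_add)
      then show ?thesis by (simp add: rp)
    qed
    finally show ?thesis using True by simp
  qed
  have "ennreal (Gamma (DIM('a) / 2 + k + \<alpha> + 1)) * A =
     (\<integral>\<^sup>+t. A * (ennreal (t powr (DIM('a) / 2 + k + \<alpha> + 1 - 1) * exp (-t)) * indicator {0..} t) \<partial>lborel)"
    using \<alpha> nn_integral_Gamma[of "DIM('a) / 2 + k + \<alpha> + 1"] by (subst nn_integral_cmult) (auto simp: mult.commute add_nonneg_pos)
  also have "\<dots> = (\<integral>\<^sup>+t. \<integral>\<^sup>+x. \<Phi> t x * indicator {0..} t \<partial>lborel \<partial>lborel)"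
    by (simp add: inner_x)
  also have "\<dots> = (\<integral>\<^sup>+x. \<integral>\<^sup>+t. \<Phi> t x * indicator {0..} t \<partial>lborel \<partial>lborel)"
    by (rule lborel_pair.Fubini') measurable
  also have "\<dots> = ennreal (Gamma (\<alpha> + 1)) * (\<integral>\<^sup>+x. ennreal (h x * exp (- (norm x)\<^sup>2)) \<partial>lborel)"
    unfolding inner_t by (subst nn_integral_multc) (simp_all add: mult.commute)
  finally show ?thesis by (simp add: A_def)
qed

section \<open>Moments of the weighted measure on the ball\<close>

lemma norm_vector_mult_complex: "norm (c *s w) = norm c * norm (w :: complex ^ 'n::finite)"
  by (simp add: norm_vec_def L2_set_def norm_mult power_mult_distrib real_sqrt_mult flip: sum_distrib_left)

lemma orthogonal_transformation_unimodular:
  assumes "norm c = 1"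
  shows "orthogonal_transformation (\<lambda>w :: complex ^ 'n::finite. c *s w)"
  unfolding orthogonal_transformation
  by (auto simp: norm_vector_mult_complex assms vec_eq_iff algebra_simps intro!: linearI)

lemma cinner_scale_right: "cinner z (c *s w) = cnj c * cinner z w"
  by (simp add: cinner_def sum_distrib_left mult_ac)

lemma Re_cinner: "Re (cinner z w) = z \<bullet> w"
  by (simp add: cinner_def inner_vec_def inner_complex_def)

lemma continuous_on_cinner [continuous_intros]:
  "continuous_on S f \<Longrightarrow> continuous_on S g \<Longrightarrow> continuous_on S (\<lambda>x. cinner (f x) (g x))"
  unfolding cinner_def by (intro continuous_intros)

lemma norm_cinner_le: "norm (cinner z w) \<le> norm z * norm w"
proof -
  have "norm (cinner z w) \<le> (\<Sum>i\<in>UNIV. \<bar>norm (z $ i)\<bar> * \<bar>norm (w $ i)\<bar>)"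
    unfolding cinner_def by (rule sum_norm_le) (simp add: norm_mult)
  also have "\<dots> \<le> norm z * norm w"
    unfolding norm_vec_def by (rule L2_set_mult_ineq)
  finally show ?thesis .
qed

section \<open>The weighted measure: measurability, reduction to \<open>lborel\<close>, rotation
  invariance\<close>

lemma space_ball_measure [simp]: "space ball_measure = unit_ball"
  by (simp add: ball_measure_def)

lemma sets_ball_measure [measurable_cong]: "sets ball_measure = sets (lebesgue_on unit_ball)"
  by (simp add: ball_measure_def)

lemma space_weighted_ball_measure [simp]: "space (weighted_ball_measure \<alpha>) = unit_ball"
  by (simp add: weighted_ball_measure_def ball_measure_def)

lemma sets_weighted_ball_measure [measurable_cong]:
  "sets (weighted_ball_measure \<alpha>) = sets (lebesgue_on unit_ball)"
  by (simp add: weighted_ball_measure_def ball_measure_def)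

lemma borel_measurable_weighted_ball_measureI:
  fixes f :: "complex ^ 'n::finite \<Rightarrow> 'b::{second_countable_topology, real_normed_vector}"
  assumes "continuous_on unit_ball f"
  shows "f \<in> borel_measurable (weighted_ball_measure \<alpha>)"
  unfolding measurable_cong_sets[OF sets_weighted_ball_measure refl]
  using assms by (rule continuous_imp_measurable_on_sets_lebesgue) simp

lemma measurable_weighted_ball_measure_borel:
  assumes "f \<in> borel_measurable borel"
  shows "f \<in> borel_measurable (weighted_ball_measure \<alpha>)" "f \<in> borel_measurable ball_measure"
  unfolding measurable_cong_sets[OF sets_weighted_ball_measure refl] measurable_cong_sets[OF sets_ball_measure refl]
  by (intro measurable_restrict_space1 measurable_completion, simp add: assms)+

lemma ball_const_pos: "\<alpha> > -1 \<Longrightarrow> ball_const n \<alpha> > 0"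
  by (simp add: ball_const_def add_nonneg_pos)

lemma emeasure_lborel_ball_pos_finite:
  fixes B :: "'a::euclidean_space set"
  defines "B \<equiv> ball 0 1"
  shows "emeasure lborel B = ennreal (measure lborel B)" "measure lborel B > 0"
proof -
  show *: "emeasure lborel B = ennreal (measure lborel B)"
    using emeasure_lborel_ball_finite[of "0::'a" 1] by (simp add: B_def emeasure_eq_ennreal_measure)
  have "emeasure lborel B \<noteq> 0"
    using open_not_negligible[of B] by (auto simp: B_def negligible_iff_null_sets null_sets_def)
  with * show "measure lborel B > 0"
    by (metis ennreal_0 measure_nonneg order_le_less)
qed

text \<open>For a Borel integrand the completed measure can be replaced by \<open>lborel\<close>,
  where the translation and dilation arguments take place.\<close>

lemma nn_integral_weighted_ball_measure:
  fixes f :: "complex ^ 'n::finite \<Rightarrow> ennreal"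
  assumes \<alpha>: "\<alpha> > -1" and [measurable]: "f \<in> borel_measurable borel"
  shows "(\<integral>\<^sup>+w. f w \<partial>weighted_ball_measure \<alpha>) =
    ennreal (ball_const CARD('n) \<alpha> / measure lborel (unit_ball :: (complex ^ 'n) set)) *
    (\<integral>\<^sup>+w. ennreal ((1 - (norm w)\<^sup>2) powr \<alpha>) * indicator unit_ball w * f w \<partial>lborel)"
proof -
  let ?B = "unit_ball :: (complex ^ 'n) set"
  let ?c = "ball_const CARD('n) \<alpha>"
  have [measurable]: "?B \<in> sets borel" "?B \<in> sets (lebesgue_on ?B)"
    by (auto simp: sets_restrict_space)
  have m: "(\<lambda>w. ennreal (?c * (1 - (norm w)\<^sup>2) powr \<alpha>) * f w) \<in> borel_measurable (lebesgue_on ?B)"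
    by (intro measurable_restrict_space1 measurable_completion) simp
  have "(\<integral>\<^sup>+w. f w \<partial>weighted_ball_measure \<alpha>) =
      (\<integral>\<^sup>+w. ennreal (?c * (1 - (norm w)\<^sup>2) powr \<alpha>) * f w \<partial>ball_measure)"
    unfolding weighted_ball_measure_def
    by (intro nn_integral_density measurable_weighted_ball_measure_borel) measurable
  also have "\<dots> = (\<integral>\<^sup>+w. (ennreal (?c * (1 - (norm w)\<^sup>2) powr \<alpha>) * f w) * indicator ?B w \<partial>lebesgue_on ?B) / emeasure (lebesgue_on ?B) ?B"
    unfolding ball_measure_def by (intro nn_integral_uniform_measure m) measurable
  also have "\<dots> = (\<integral>\<^sup>+w. ennreal (?c * (1 - (norm w)\<^sup>2) powr \<alpha>) * f w * indicator ?B w \<partial>lborel) / emeasure lborel ?B"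
    by (simp add: nn_integral_restrict_space nn_integral_completion emeasure_restrict_space mult.assoc flip: indicator_inter_arith)
  also have "(\<integral>\<^sup>+w. ennreal (?c * (1 - (norm w)\<^sup>2) powr \<alpha>) * f w * indicator ?B w \<partial>lborel) =
      (\<integral>\<^sup>+w. ennreal ?c * (ennreal ((1 - (norm w)\<^sup>2) powr \<alpha>) * indicator ?B w * f w) \<partial>lborel)"
    using ball_const_pos[OF \<alpha>, of "CARD('n)"] by (intro nn_integral_cong) (simp add: ennreal_mult mult_ac)
  also have "\<dots> = ennreal ?c * (\<integral>\<^sup>+w. ennreal ((1 - (norm w)\<^sup>2) powr \<alpha>) * indicator ?B w * f w \<partial>lborel)"
    by (intro nn_integral_cmult) measurable
  also have "\<dots> / emeasure lborel ?B = ennreal (?c / measure lborel ?B) * (\<integral>\<^sup>+w. ennreal ((1 - (norm w)\<^sup>2) powr \<alpha>) * indicator ?B w * f w \<partial>lborel)"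
    using emeasure_lborel_ball_pos_finite[where 'a="complex ^ 'n"] ball_const_pos[OF \<alpha>, of "CARD('n)"]
    by (simp add: divide_ennreal[symmetric] ennreal_times_divide divide_ennreal_def mult_ac)
  finally show ?thesis .
qed

text \<open>The weight depends on |w| only, and multiplication by \<open>c\<close> is an orthogonal
  map, which preserves \<open>lborel\<close>.\<close>

lemma integral_weighted_ball_measure_rotate:
  fixes f :: "complex ^ 'n::finite \<Rightarrow> 'b::{second_countable_topology, banach}"
  assumes \<alpha>: "\<alpha> > -1" and c: "norm c = 1" and f [measurable]: "f \<in> borel_measurable borel"
  shows "(\<integral>w. f (c *s w) \<partial>weighted_ball_measure \<alpha>) = (\<integral>w. f w \<partial>weighted_ball_measure \<alpha>)"
proof -
  let ?\<mu> = "weighted_ball_measure \<alpha> :: (complex ^ 'n) measure"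
  let ?T = "\<lambda>w :: complex ^ 'n. c *s w"
  have [measurable]: "unit_ball \<in> sets (borel :: (complex ^ 'n) measure)" by simp
  have T: "orthogonal_transformation ?T"
    using c by (rule orthogonal_transformation_unimodular)
  have T' [measurable]: "?T \<in> borel_measurable borel"
    using orthogonal_transformation_linear[OF T]
    by (intro borel_measurable_continuous_onI linear_continuous_on linear_conv_bounded_linear[THEN iffD1])
  have id: "(\<lambda>w. w) \<in> ?\<mu> \<rightarrow>\<^sub>M borel"
    by (rule measurable_weighted_ball_measure_borel) simp
  have TM: "?T \<in> ?\<mu> \<rightarrow>\<^sub>M borel"
    by (rule measurable_weighted_ball_measure_borel) simp
  \<comment> \<open>The weighted measure lives on the Lebesgue sets of the ball. Pushing it forward
    by the identity as well puts both measures on the Borel sets of the whole space.\<close>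
  have "distr ?\<mu> borel ?T = distr ?\<mu> borel (\<lambda>w. w)"
  proof (rule measure_eqI)
    fix A assume "A \<in> sets (distr ?\<mu> borel ?T)"
    then have [measurable]: "A \<in> sets borel" by simp
    let ?k = "ennreal (ball_const CARD('n) \<alpha> / measure lborel (unit_ball :: (complex ^ 'n) set))"
    let ?F = "\<lambda>w :: complex ^ 'n. ennreal ((1 - (norm w)\<^sup>2) powr \<alpha>) * indicator unit_ball w * indicator A w"
    have "emeasure (distr ?\<mu> borel ?T) A = (\<integral>\<^sup>+w. indicator A (?T w) \<partial>?\<mu>)"
      using TM by (simp add: nn_integral_distr flip: nn_integral_indicator)
    also have "\<dots> = ?k * (\<integral>\<^sup>+w. ?F (?T w) \<partial>lborel)"
      using nn_integral_weighted_ball_measure[OF \<alpha>, of "\<lambda>w. indicator A (?T w)"]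
      by (simp add: norm_vector_mult_complex c indicator_def)
    also have "(\<integral>\<^sup>+w. ?F (?T w) \<partial>lborel) = (\<integral>\<^sup>+w. ?F w \<partial>distr lborel borel ?T)"
      by (subst nn_integral_distr) measurable
    also have "\<dots> = (\<integral>\<^sup>+w. ?F w \<partial>lborel)"
      by (simp add: distr_lborel_orthogonal_transformation[OF T])
    also have "?k * \<dots> = (\<integral>\<^sup>+w. indicator A w \<partial>?\<mu>)"
      by (subst nn_integral_weighted_ball_measure[OF \<alpha>]) auto
    also have "\<dots> = emeasure (distr ?\<mu> borel (\<lambda>w. w)) A"
      using id by (simp add: nn_integral_distr flip: nn_integral_indicator)
    finally show "emeasure (distr ?\<mu> borel ?T) A = emeasure (distr ?\<mu> borel (\<lambda>w. w)) A" .
  qed simp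
  then show ?thesis
    using integral_distr[OF TM f] integral_distr[OF id f] by simp
qed

text \<open>The integrand is homogeneous of degree 2k and the real dimension is 2n, so the
  comparison with the Gaussian involves Gamma at \<open>s + k\<close>. Its quotient by the
  \<open>Gamma s\<close> in \<open>ball_const\<close> is the rising factorial.\<close>

lemma nn_integral_weighted_even_moment:
  fixes z :: "complex ^ 'n::finite"
  assumes \<alpha>: "\<alpha> > -1"
  defines "s \<equiv> real CARD('n) + 1 + \<alpha>"
  shows "(\<integral>\<^sup>+w. ennreal ((z \<bullet> w) ^ (2 * k)) \<partial>weighted_ball_measure \<alpha>) =
    ennreal (fact (2 * k) / (4 ^ k * fact k * pochhammer s k) * norm z ^ (2 * k))"
proof -
  let ?B = "unit_ball :: (complex ^ 'n) set"
  define V where "V = measure lborel ?B"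
  define n where "n = real CARD('n)"
  have n: "n > 0" "DIM(complex ^ 'n) / 2 = n" by (simp_all add: n_def)
  have V: "V > 0" "emeasure lborel ?B = ennreal V"
    using emeasure_lborel_ball_pos_finite[where 'a="complex ^ 'n"] by (simp_all add: V_def)
  have [measurable]: "?B \<in> sets borel" by simp
  have sp: "s > 0" using \<alpha> by (simp add: s_def add_nonneg_pos)
  \<comment> \<open>The case h = 1, k = 0 and weight exponent 0 expresses the Gaussian mass through
    the volume \<open>V\<close>. Hence \<open>V\<close> cancels against the normalisation and its
    value is never computed.\<close>
  have "ennreal (Gamma (DIM(complex^'n) / 2 + (0::nat) + 0 + 1)) *
      (\<integral>\<^sup>+x. ennreal (1 * (1 - (norm (x :: complex ^ 'n))\<^sup>2) powr 0) * indicator ?B x \<partial>lborel) =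
    ennreal (Gamma (0 + 1)) * (\<integral>\<^sup>+x. ennreal (1 * exp (- (norm (x :: complex ^ 'n))\<^sup>2)) \<partial>lborel)"
    by (rule nn_integral_ball_homogeneous) auto
  also have "(\<integral>\<^sup>+x. ennreal (1 * (1 - (norm (x :: complex ^ 'n))\<^sup>2) powr 0) * indicator ?B x \<partial>lborel) =
      (\<integral>\<^sup>+x. indicator ?B x \<partial>lborel)"
    by (intro nn_integral_cong) (auto simp: indicator_def abs_square_eq_1)
  finally have G: "(\<integral>\<^sup>+x. ennreal (exp (- (norm (x :: complex ^ 'n))\<^sup>2)) \<partial>lborel) = ennreal (Gamma (n + 1) * V)"
    using n V by (simp add: n_def ennreal_mult' mult.commute)
  have Gn: "Gamma (n + 1) > 0" "Gamma (s + real k) > 0" "Gamma s > 0" "Gamma (\<alpha> + 1) > 0"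
    using n sp \<alpha> by (auto intro!: Gamma_real_pos)
  define X where "X = (\<integral>\<^sup>+x. ennreal ((z \<bullet> x) ^ (2 * k) * (1 - (norm x)\<^sup>2) powr \<alpha>) * indicator ?B x \<partial>lborel)"
  have "ennreal (Gamma (DIM(complex^'n) / 2 + k + \<alpha> + 1)) * X =
    ennreal (Gamma (\<alpha> + 1)) * (\<integral>\<^sup>+x. ennreal ((z \<bullet> x) ^ (2 * k) * exp (- (norm x)\<^sup>2)) \<partial>lborel)"
    unfolding X_def using \<alpha>
    by (intro nn_integral_ball_homogeneous) (auto simp: power_mult_distrib)
  also have "\<dots> = ennreal (Gamma (\<alpha> + 1) * (Gamma (n + 1) * V * fact (2 * k) / (4 ^ k * fact k) * norm z ^ (2 * k)))"
    using Gn V by (subst nn_integral_gaussian_even_moment[OF G], simp) (rule ennreal_mult'[symmetric], simp)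
  also have "DIM(complex^'n) / 2 + k + \<alpha> + 1 = s + k"
    by (simp add: s_def)
  finally have X: "ennreal (Gamma (s + k)) * X = ennreal (Gamma (\<alpha> + 1) * (Gamma (n + 1) * V * fact (2 * k) / (4 ^ k * fact k) * norm z ^ (2 * k)))" .
  define R where "R = Gamma (\<alpha> + 1) * (Gamma (n + 1) * V * fact (2 * k) / (4 ^ k * fact k) * norm z ^ (2 * k)) / Gamma (s + k)"
  have "ennreal (Gamma (s + k)) * X = ennreal (Gamma (s + k)) * ennreal R"
    unfolding X R_def using Gn by (subst ennreal_mult'[symmetric]) auto
  then have XR: "X = ennreal R"
    using Gn by (simp add: ennreal_mult_cancel_left)
  have "(\<integral>\<^sup>+w. ennreal ((z \<bullet> w) ^ (2 * k)) \<partial>weighted_ball_measure \<alpha>) =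
      ennreal (ball_const CARD('n) \<alpha> / V) * X"
    unfolding X_def V_def
    by (subst nn_integral_weighted_ball_measure[OF \<alpha>], simp, rule arg_cong2[where f="(*)"], rule refl,
        rule nn_integral_cong) (simp add: indicator_def mult.commute ennreal_mult'')
  also have "\<dots> = ennreal (ball_const CARD('n) \<alpha> / V * R)"
    unfolding XR using ball_const_pos[OF \<alpha>, of "CARD('n)"] V by (intro ennreal_mult'[symmetric]) auto
  also have "ball_const CARD('n) \<alpha> = Gamma s / (Gamma (n + 1) * Gamma (\<alpha> + 1))"
    by (simp add: ball_const_def s_def n_def add_ac)
  also have "Gamma s / (Gamma (n + 1) * Gamma (\<alpha> + 1)) / V * R =
      fact (2 * k) / (4 ^ k * fact k * (Gamma (s + k) / Gamma s)) * norm z ^ (2 * k)"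
    using Gn V by (simp add: R_def divide_simps)
  also have "Gamma (s + k) / Gamma s = pochhammer s k"
    using sp by (intro pochhammer_Gamma[symmetric]) (auto elim!: nonpos_Ints_cases)
  finally show ?thesis .
qed

text \<open>The total mass is the moment of order 0, with \<open>0 ^ 0 = 1\<close>.\<close>

lemma emeasure_weighted_ball_measure_space:
  assumes "\<alpha> > -1"
  shows "emeasure (weighted_ball_measure \<alpha>) (unit_ball :: (complex ^ 'n::finite) set) = 1"
  using nn_integral_weighted_even_moment[OF assms, of "0 :: complex ^ 'n" 0] by simp

lemma finite_measure_weighted_ball_measure:
  "\<alpha> > -1 \<Longrightarrow> finite_measure (weighted_ball_measure \<alpha> :: (complex ^ 'n::finite) measure)"
  by (rule finite_measureI) (simp add: emeasure_weighted_ball_measure_space)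

lemma integrable_weighted_ball_measureI:
  fixes f :: "complex ^ 'n::finite \<Rightarrow> 'b::{second_countable_topology, banach}"
  assumes "\<alpha> > -1" "continuous_on unit_ball f" "\<And>w. w \<in> unit_ball \<Longrightarrow> norm (f w) \<le> C"
  shows "integrable (weighted_ball_measure \<alpha>) f"
proof -
  interpret finite_measure "weighted_ball_measure \<alpha> :: (complex ^ 'n) measure"
    by (rule finite_measure_weighted_ball_measure) fact
  show ?thesis
    using assms by (intro integrable_const_bound[where B=C] borel_measurable_weighted_ball_measureI) auto
qed

lemma norm_cinner_less_1: "norm z \<le> 1 \<Longrightarrow> w \<in> unit_ball \<Longrightarrow> norm (cinner z w) < 1"
  using norm_cinner_le[of z w] mult_right_mono[of "norm z" 1 "norm w"] by simp

text \<open>A suitable rotation of \<open>w\<close> leaves the integral unchanged but reverses the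
  sign of the integrand.\<close>

lemma integral_cinner_power_orthogonal:
  fixes z :: "complex ^ 'n::finite"
  assumes \<alpha>: "\<alpha> > -1" and "j \<noteq> k"
  shows "(\<integral>w. cinner z w ^ j * cnj (cinner z w) ^ k \<partial>weighted_ball_measure \<alpha>) = 0"
proof -
  let ?\<mu> = "weighted_ball_measure \<alpha> :: (complex ^ 'n) measure"
  let ?f = "\<lambda>w. cinner z w ^ j * cnj (cinner z w) ^ k"
  \<comment> \<open>Rotation by this angle multiplies the integrand by exp(i(k - j)\<theta>) =
    exp(i\<pi>) = -1.\<close>
  define \<theta> where "\<theta> = pi / (real k - real j)"
  define c where "c = cis \<theta>"
  have "cnj c ^ j * c ^ k = cis (real j * - \<theta>) * cis (real k * \<theta>)"
    by (simp add: c_def cis_cnj Complex.DeMoivre)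
  also have "\<dots> = cis ((real k - real j) * \<theta>)"
    by (simp add: cis_mult algebra_simps)
  also have "(real k - real j) * \<theta> = pi"
    using \<open>j \<noteq> k\<close> by (simp add: \<theta>_def)
  finally have c: "cnj c ^ j * c ^ k = -1" by simp
  have [measurable]: "?f \<in> borel_measurable borel"
    by (intro borel_measurable_continuous_onI continuous_intros)
  have "(\<integral>w. ?f w \<partial>?\<mu>) = (\<integral>w. ?f (c *s w) \<partial>?\<mu>)"
    by (rule integral_weighted_ball_measure_rotate[OF \<alpha>, symmetric]) (simp_all add: c_def)
  also have "\<dots> = (\<integral>w. - ?f w \<partial>?\<mu>)"
  proof (intro Bochner_Integration.integral_cong refl)
    fix w
    have "?f (c *s w) = (cnj c ^ j * c ^ k) * ?f w"
      by (simp add: cinner_scale_right power_mult_distrib mult_ac)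
    then show "?f (c *s w) = - ?f w" by (simp add: c)
  qed
  finally show ?thesis by simp
qed

text \<open>In the binomial expansion of \<open>(2 Re \<langle>z,w\<rangle>)\<^sup>2\<^sup>k\<close> only the middle term survives integration.\<close>

lemma integral_cinner_power_norm:
  fixes z :: "complex ^ 'n::finite"
  assumes \<alpha>: "\<alpha> > -1" and z: "norm z \<le> 1"
  shows "(\<integral>w. cinner z w ^ k * cnj (cinner z w) ^ k \<partial>weighted_ball_measure \<alpha>) =
    complex_of_real (fact k / pochhammer (real CARD('n) + 1 + \<alpha>) k * norm z ^ (2 * k))"
proof -
  let ?\<mu> = "weighted_ball_measure \<alpha> :: (complex ^ 'n) measure"
  let ?p = "pochhammer (real CARD('n) + 1 + \<alpha>) k"
  define J where "J i j = (\<integral>w. cinner z w ^ i * cnj (cinner z w) ^ j \<partial>?\<mu>)" for i j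
  have p: "?p > 0" using \<alpha> by (intro pochhammer_pos) (simp add: add_nonneg_pos)
  have int: "integrable ?\<mu> (\<lambda>w. cinner z w ^ i * cnj (cinner z w) ^ j)" for i j
    using \<alpha> by (rule integrable_weighted_ball_measureI[where C=1])
       (auto intro!: continuous_intros mult_le_one power_le_one less_imp_le[OF norm_cinner_less_1] z
          simp: norm_mult norm_power)
  have real: "(\<integral>w. (z \<bullet> w) ^ (2 * k) \<partial>?\<mu>) = fact (2 * k) / (4 ^ k * fact k * ?p) * norm z ^ (2 * k)"
    using p by (subst integral_eq_nn_integral)
      (auto simp: nn_integral_weighted_even_moment[OF \<alpha>] intro!: borel_measurable_weighted_ball_measureI continuous_intros)
  have "4 ^ k * complex_of_real (\<integral>w. (z \<bullet> w) ^ (2 * k) \<partial>?\<mu>) = (\<integral>w. 4 ^ k * complex_of_real ((z \<bullet> w) ^ (2 * k)) \<partial>?\<mu>)"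
    by (simp del: of_real_power)
  also have "\<dots> = (\<integral>w. (\<Sum>i\<le>2 * k. of_nat (2 * k choose i) * (cinner z w ^ i * cnj (cinner z w) ^ (2 * k - i))) \<partial>?\<mu>)"
  proof (intro Bochner_Integration.integral_cong refl)
    fix w
    have "4 ^ k * complex_of_real ((z \<bullet> w) ^ (2 * k)) = (2 * complex_of_real (Re (cinner z w))) ^ (2 * k)"
      by (simp add: Re_cinner power_mult_distrib power_mult)
    also have "2 * complex_of_real (Re (cinner z w)) = cinner z w + cnj (cinner z w)"
      by (simp add: complex_add_cnj)
    finally show "4 ^ k * complex_of_real ((z \<bullet> w) ^ (2 * k)) =
        (\<Sum>i\<le>2 * k. of_nat (2 * k choose i) * (cinner z w ^ i * cnj (cinner z w) ^ (2 * k - i)))"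
      by (simp add: binomial_ring mult.assoc)
  qed
  also have "\<dots> = (\<Sum>i\<le>2 * k. of_nat (2 * k choose i) * J i (2 * k - i))"
    unfolding J_def by (subst Bochner_Integration.integral_sum) (auto intro!: integrable_mult_right int)
  also have "\<dots> = (\<Sum>i\<le>2 * k. if i = k then of_nat (2 * k choose k) * J k k else 0)"
    by (intro sum.cong) (auto simp: J_def integral_cinner_power_orthogonal[OF \<alpha>])
  also have "\<dots> = of_nat (2 * k choose k) * J k k"
    by simp
  finally have "of_nat (2 * k choose k) * J k k = 4 ^ k * complex_of_real (fact (2 * k) / (4 ^ k * fact k * ?p) * norm z ^ (2 * k))"
    by (simp only: real)
  also have "\<dots> = complex_of_real (fact (2 * k) / (fact k * ?p) * norm z ^ (2 * k))"
    by simp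
  also have "fact (2 * k) / (fact k * ?p) * norm z ^ (2 * k) = real (2 * k choose k) * (fact k / ?p * norm z ^ (2 * k))"
    using p by (simp add: binomial_fact)
  finally have "of_nat (2 * k choose k) * J k k = of_nat (2 * k choose k) * complex_of_real (fact k / ?p * norm z ^ (2 * k))"
    by (simp only: of_real_mult of_real_of_nat_eq)
  moreover have "of_nat (2 * k choose k) \<noteq> (0 :: complex)"
    unfolding of_nat_eq_0_iff by simp
  ultimately have "J k k = complex_of_real (fact k / ?p * norm z ^ (2 * k))"
    by (metis mult_left_cancel)
  then show ?thesis unfolding J_def .
qed

section \<open>The integrals of Forelli and Rudin\<close>

text \<open>The two factors \<open>(-1) ^ k\<close> cancel, which rewrites Newton's series of
  \<open>(1 - x) powr (-a)\<close> with rising factorials.\<close>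

lemma gbinomial_minus_mult_power:
  fixes a x :: "'a::field_char_0"
  shows "((-a) gchoose k) * (-x) ^ k = pochhammer a k / fact k * x ^ k"
proof -
  have "((-a) gchoose k) * (-x) ^ k = ((-1) ^ k * (-1) ^ k) * (pochhammer a k / fact k * x ^ k)"
    by (simp only: gbinomial_pochhammer power_minus[of x] minus_minus divide_inverse mult_ac)
  also have "(-1) ^ k * (-1) ^ k = (1 :: 'a)"
    by (simp flip: power_mult_distrib)
  finally show ?thesis by simp
qed

lemma binomial_series_real:
  fixes x a :: real
  assumes "\<bar>x\<bar> < 1"
  shows "(\<lambda>k. pochhammer a k / fact k * x ^ k) sums (1 - x) powr (-a)"
  using gen_binomial_real[of "-x" "-a"] assms unfolding gbinomial_minus_mult_power by simp

lemma binomial_series_complex: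
  fixes x :: complex and a :: real
  assumes "norm x < 1"
  shows "(\<lambda>k. complex_of_real (pochhammer a k / fact k) * x ^ k) sums (1 - x) powr (- complex_of_real a)"
  using gen_binomial_complex[of "-x" "- complex_of_real a"] assms
  unfolding gbinomial_minus_mult_power by (simp add: pochhammer_of_real)

lemma Re_cinner_less_1: "norm z < 1 \<Longrightarrow> w \<in> unit_ball \<Longrightarrow> Re (cinner z w) < 1"
  using norm_cinner_less_1[of z w] complex_Re_le_cmod[of "cinner z w"] by linarith

lemma continuous_on_cinner_powr [continuous_intros]:
  "norm z < 1 \<Longrightarrow> continuous_on unit_ball (\<lambda>w. (1 - cinner z w) powr p)"
  by (intro continuous_on_powr_complex continuous_intros)
     (use Re_cinner_less_1[of z] in \<open>force simp: complex_nonpos_Reals_iff\<close>)+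

lemma norm_one_minus_cinner_ge:
  assumes "norm z < 1" "w \<in> unit_ball"
  shows "1 - norm z \<le> norm (1 - cinner z w)" "1 - norm (cinner z w) \<le> norm (1 - cinner z w)" "norm (1 - cinner z w) > 0"
proof -
  have "norm (cinner z w) \<le> norm z"
    using norm_cinner_le[of z w] mult_left_mono[of "norm w" 1 "norm z"] assms by simp
  moreover show "1 - norm (cinner z w) \<le> norm (1 - cinner z w)"
    using norm_triangle_ineq2[of 1 "cinner z w"] by simp
  ultimately show "1 - norm z \<le> norm (1 - cinner z w)" by linarith
  with assms show "norm (1 - cinner z w) > 0" by linarith
qed

lemma norm_one_minus_cinner_powr_le:
  assumes "norm z < 1" "w \<in> unit_ball" "p \<ge> 0"
  shows "norm (1 - cinner z w) powr (-p) \<le> (1 - norm z) powr (-p)"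
  using assms norm_one_minus_cinner_ge[of z w] by (intro powr_mono2') auto

text \<open>On the ball |<z,w>| \<le> |z|, so the binomial series at |z| times \<open>S\<close>
  dominates the integrated series and allows the exchange. The factor \<open>h\<close> will be first
  a conjugate power of <z,w>, then the conjugate kernel itself.\<close>

lemma binomial_kernel_integral_sums:
  fixes z :: "complex ^ 'n::finite"
  assumes \<alpha>: "\<alpha> > -1" and z: "norm z < 1" and a: "a > 0"
    and h: "continuous_on unit_ball h" and hS: "\<And>w. w \<in> unit_ball \<Longrightarrow> norm (h w) \<le> S"
  shows "(\<lambda>k. complex_of_real (pochhammer a k / fact k) * (\<integral>w. cinner z w ^ k * h w \<partial>weighted_ball_measure \<alpha>)) sums
    (\<integral>w. (1 - cinner z w) powr (- complex_of_real a) * h w \<partial>weighted_ball_measure \<alpha>)"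
proof -
  let ?\<mu> = "weighted_ball_measure \<alpha> :: (complex ^ 'n) measure"
  interpret finite_measure ?\<mu> using \<alpha> by (rule finite_measure_weighted_ball_measure)
  let ?c = "\<lambda>k. pochhammer a k / fact k"
  have c: "?c k \<ge> 0" for k using pochhammer_pos[OF a, of k] by simp
  have S: "S \<ge> 0" using hS[of 0] by (meson centre_in_ball norm_ge_zero order_trans zero_less_one)
  define f where "f k w = complex_of_real (?c k) * (cinner z w ^ k * h w)" for k w
  have zw: "norm (cinner z w) \<le> norm z" if "w \<in> unit_ball" for w
    using norm_cinner_le[of z w] mult_left_mono[of "norm w" 1 "norm z"] that by simp
  have bound: "norm (f k w) \<le> ?c k * norm z ^ k * S" if "w \<in> unit_ball" for k w
  proof -
    have "norm (cinner z w ^ k) \<le> norm z ^ k"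
      using zw[OF that] by (simp add: norm_power power_mono)
    then show ?thesis
      using hS[OF that] S c[of k] unfolding f_def
      by (simp only: norm_mult norm_of_real mult.assoc abs_of_nonneg)
         (intro mult_left_mono mult_mono, auto)
  qed
  have sm: "summable (\<lambda>k. ?c k * norm z ^ k * S)"
    using binomial_series_real[of "norm z" a] z by (intro summable_mult2) (auto simp: sums_iff)
  have int: "integrable ?\<mu> (f k)" for k
    by (rule integrable_weighted_ball_measureI[OF \<alpha> _ bound])
       (auto simp: f_def intro!: continuous_intros h)
  have "(\<lambda>k. \<integral>w. f k w \<partial>?\<mu>) sums (\<integral>w. (\<Sum>k. f k w) \<partial>?\<mu>)"
  proof (rule sums_integral[OF int])
    show "AE w in ?\<mu>. summable (\<lambda>k. norm (f k w))"
      using summable_comparison_test'[OF sm, of 0 "\<lambda>k. norm (f k _)"] bound by (intro AE_I2) simp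
    have "norm (\<integral>w. norm (f k w) \<partial>?\<mu>) \<le> ?c k * norm z ^ k * S" for k
    proof -
      have "(\<integral>w. norm (f k w) \<partial>?\<mu>) \<le> (\<integral>w. ?c k * norm z ^ k * S \<partial>?\<mu>)"
        using bound int by (intro integral_mono) auto
      also have "\<dots> = ?c k * norm z ^ k * S"
        using emeasure_weighted_ball_measure_space[OF \<alpha>, where 'n='n] by (simp add: measure_def)
      finally show ?thesis by (simp add: integral_nonneg_AE)
    qed
    then show "summable (\<lambda>k. \<integral>w. norm (f k w) \<partial>?\<mu>)"
      by (intro summable_comparison_test'[OF sm, of 0]) auto
  qed
  also have "(\<lambda>k. \<integral>w. f k w \<partial>?\<mu>) = (\<lambda>k. complex_of_real (?c k) * (\<integral>w. cinner z w ^ k * h w \<partial>?\<mu>))"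
    by (simp only: f_def integral_mult_right_zero)
  also have "(\<integral>w. (\<Sum>k. f k w) \<partial>?\<mu>) = (\<integral>w. (1 - cinner z w) powr (- complex_of_real a) * h w \<partial>?\<mu>)"
  proof (rule Bochner_Integration.integral_cong[OF refl])
    fix w assume "w \<in> space ?\<mu>"
    then have "norm (cinner z w) < 1" using zw[of w] z by simp
    from sums_mult2[OF binomial_series_complex[OF this, of a], of "h w"]
    show "(\<Sum>k. f k w) = (1 - cinner z w) powr (- complex_of_real a) * h w"
      by (simp add: f_def sums_iff mult.assoc)
  qed
  finally show ?thesis .
qed

text \<open>The integrand is the kernel with exponent \<open>-a\<close> times its own conjugate, so
  this is Parseval's identity for the orthogonal powers of <z,w>.\<close>

lemma forelli_rudin_sums:
  fixes z :: "complex ^ 'n::finite"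
  assumes \<alpha>: "\<alpha> > -1" and z: "norm z < 1" and a: "a > 0"
  shows "(\<lambda>k. (pochhammer a k)\<^sup>2 / (fact k * pochhammer (real CARD('n) + 1 + \<alpha>) k) * (norm z)\<^sup>2 ^ k) sums
    (\<integral>w. norm (1 - cinner z w) powr (- (2 * a)) \<partial>weighted_ball_measure \<alpha>)"
proof -
  let ?\<mu> = "weighted_ball_measure \<alpha> :: (complex ^ 'n) measure"
  let ?p = "pochhammer (real CARD('n) + 1 + \<alpha>)"
  let ?c = "\<lambda>k. pochhammer a k / fact k"
  let ?f = "\<lambda>w. (1 - cinner z w) powr (- complex_of_real a)"
  have nf: "norm (?f w) = norm (1 - cinner z w) powr (-a)" if "w \<in> unit_ball" for w
    by (simp add: norm_powr_real_powr')
  have bf: "norm (?f w) \<le> (1 - norm z) powr (-a)" if "w \<in> unit_ball" for w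
    unfolding nf[OF that] using norm_one_minus_cinner_powr_le[OF z that, of a] a by simp
  have inner: "(\<integral>w. cinner z w ^ k * cnj (?f w) \<partial>?\<mu>) = complex_of_real (?c k * (fact k / ?p k * norm z ^ (2 * k)))" for k
  proof -
    \<comment> \<open>Expanding the kernel against the k-th conjugate power leaves only the term
      \<open>j = k\<close>.\<close>
    have "(\<lambda>j. complex_of_real (?c j) * (\<integral>w. cinner z w ^ j * cnj (cinner z w) ^ k \<partial>?\<mu>)) sums (\<integral>w. ?f w * cnj (cinner z w) ^ k \<partial>?\<mu>)"
      using \<alpha> z a by (rule binomial_kernel_integral_sums[where S=1])
        (auto intro!: continuous_intros power_le_one less_imp_le[OF norm_cinner_less_1] simp: norm_power z less_imp_le)
    also have "(\<lambda>j. complex_of_real (?c j) * (\<integral>w. cinner z w ^ j * cnj (cinner z w) ^ k \<partial>?\<mu>)) =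
        (\<lambda>j. if j = k then complex_of_real (?c k * (fact k / ?p k * norm z ^ (2 * k))) else 0)"
    proof (rule ext)
      fix j
      show "complex_of_real (?c j) * (\<integral>w. cinner z w ^ j * cnj (cinner z w) ^ k \<partial>?\<mu>) =
          (if j = k then complex_of_real (?c k * (fact k / ?p k * norm z ^ (2 * k))) else 0)"
      proof (cases "j = k")
        case True
        then show ?thesis
          by (simp only: integral_cinner_power_norm[OF \<alpha> less_imp_le[OF z]] of_real_mult if_True simp_thms)
      next
        case False
        then show ?thesis
          by (simp add: integral_cinner_power_orthogonal[OF \<alpha>])
      qed
    qed
    finally have eq: "(\<integral>w. ?f w * cnj (cinner z w) ^ k \<partial>?\<mu>) = complex_of_real (?c k * (fact k / ?p k * norm z ^ (2 * k)))"
      by (rule sums_unique2) (rule sums_single)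
    have "(\<integral>w. cinner z w ^ k * cnj (?f w) \<partial>?\<mu>) = (\<integral>w. cnj (?f w * cnj (cinner z w) ^ k) \<partial>?\<mu>)"
      by (simp add: mult.commute)
    also have "\<dots> = cnj (\<integral>w. ?f w * cnj (cinner z w) ^ k \<partial>?\<mu>)"
      by (rule Bochner_Integration.integral_cnj)
    finally show ?thesis
      unfolding eq complex_cnj_complex_of_real .
  qed
  \<comment> \<open>A second expansion, now against the conjugate kernel, whose coefficients are
    given by \<open>inner\<close>.\<close>
  have "(\<lambda>k. complex_of_real (?c k) * (\<integral>w. cinner z w ^ k * cnj (?f w) \<partial>?\<mu>)) sums (\<integral>w. ?f w * cnj (?f w) \<partial>?\<mu>)"
    using \<alpha> z a by (rule binomial_kernel_integral_sums[where S="(1 - norm z) powr (-a)"])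
      (auto intro!: continuous_intros z simp: bf)
  also have "(\<lambda>k. complex_of_real (?c k) * (\<integral>w. cinner z w ^ k * cnj (?f w) \<partial>?\<mu>)) =
      (\<lambda>k. complex_of_real ((pochhammer a k)\<^sup>2 / (fact k * ?p k) * (norm z)\<^sup>2 ^ k))"
    unfolding inner of_real_mult[symmetric] by (intro ext arg_cong[where f=complex_of_real]) (simp add: power2_eq_square power_mult)
  also have "(\<integral>w. ?f w * cnj (?f w) \<partial>?\<mu>) = (\<integral>w. complex_of_real (norm (1 - cinner z w) powr (- (2 * a))) \<partial>?\<mu>)"
  proof (rule Bochner_Integration.integral_cong[OF refl])
    fix w assume "w \<in> space ?\<mu>"
    then have "(norm (?f w))\<^sup>2 = norm (1 - cinner z w) powr (- (2 * a))"
      by (simp add: nf power2_eq_square flip: powr_add)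
    then show "?f w * cnj (?f w) = complex_of_real (norm (1 - cinner z w) powr (- (2 * a)))"
      by (metis complex_norm_square)
  qed
  finally show ?thesis
    by (simp only: integral_complex_of_real sums_of_real_iff)
qed

section \<open>Behaviour of the coefficients and Abel means\<close>

text \<open>\<open>Gamma_series'\<close> converges to Gamma, so this form isolates the growth of the
  coefficients in a single power of \<open>k\<close>.\<close>

lemma pochhammer_ratio_eq:
  fixes a s :: real
  assumes "a > 0" "s > 0" "k > 0"
  shows "(pochhammer a k)\<^sup>2 / (fact k * pochhammer s k) =
    Gamma_series' s k / (Gamma_series' a k)\<^sup>2 * real k powr (2 * a - s - 1)"
proof -
  have ps: "pochhammer a k > 0" "pochhammer s k > 0"
    using assms by (auto intro: pochhammer_pos)
  have e: "exp (x * ln (real k)) = real k powr x" for x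
    using assms by (simp add: powr_def)
  have "fact k = real k * fact (k - 1)"
    using assms fact_reduce[of k] by simp
  moreover have "real k powr (2 * a - s - 1) = (real k powr a)\<^sup>2 / (real k powr s * real k)"
  proof -
    have "2 * a - s - 1 = (a + a) - (s + 1)" by simp
    then show ?thesis using assms by (simp only: powr_diff powr_add power2_eq_square) simp
  qed
  ultimately show ?thesis
    using ps assms unfolding Gamma_series'_def
    by (simp add: e divide_simps power2_eq_square mult_ac)
qed

text \<open>The power of \<open>k\<close> has exponent 0 in the first case and -1 in the second.
  With \<open>a = q / 2\<close> and \<open>s = p\<close> these are \<open>q = p + 1\<close> and
  \<open>q = p\<close>.\<close>

lemma pochhammer_ratio_LIMSEQ:
  fixes a s :: real
  assumes "a > 0" "s > 0"
  shows "2 * a = s + 1 \<Longrightarrow> (\<lambda>k. (pochhammer a k)\<^sup>2 / (fact k * pochhammer s k)) \<longlonglongrightarrow> Gamma s / (Gamma a)\<^sup>2"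
    and "2 * a = s \<Longrightarrow> (\<lambda>k. (pochhammer a k)\<^sup>2 / (fact k * pochhammer s k)) \<longlonglongrightarrow> 0"
proof -
  have G: "(\<lambda>k. Gamma_series' s k / (Gamma_series' a k)\<^sup>2) \<longlonglongrightarrow> Gamma s / (Gamma a)\<^sup>2"
    using Gamma_real_pos[OF assms(1)] by (intro tendsto_intros Gamma_series'_LIMSEQ) simp
  have ev: "\<forall>\<^sub>F k in sequentially. Gamma_series' s k / (Gamma_series' a k)\<^sup>2 * real k powr (2 * a - s - 1)
      = (pochhammer a k)\<^sup>2 / (fact k * pochhammer s k)"
    using eventually_gt_at_top[of 0] by eventually_elim (simp add: pochhammer_ratio_eq assms)
  show "(\<lambda>k. (pochhammer a k)\<^sup>2 / (fact k * pochhammer s k)) \<longlonglongrightarrow> Gamma s / (Gamma a)\<^sup>2" if "2 * a = s + 1"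
  proof (rule Lim_transform_eventually[OF G])
    show "\<forall>\<^sub>F k in sequentially. Gamma_series' s k / (Gamma_series' a k)\<^sup>2 = (pochhammer a k)\<^sup>2 / (fact k * pochhammer s k)"
      using ev eventually_gt_at_top[of 0] by eventually_elim (simp add: that)
  qed
  show "(\<lambda>k. (pochhammer a k)\<^sup>2 / (fact k * pochhammer s k)) \<longlonglongrightarrow> 0" if "2 * a = s"
  proof -
    have "(\<lambda>k. real k powr (2 * a - s - 1)) \<longlonglongrightarrow> 0"
      unfolding that by (rule tendsto_neg_powr) (auto simp: filterlim_real_sequentially)
    from tendsto_mult[OF G this]
    have "(\<lambda>k. Gamma_series' s k / (Gamma_series' a k)\<^sup>2 * real k powr (2 * a - s - 1)) \<longlonglongrightarrow> 0" by simp
    then show ?thesis using ev by (rule Lim_transform_eventually)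
  qed
qed

text \<open>The quotient of consecutive terms is (a + k)^2 / ((k + 1)(s + k)), whose numerator
  exceeds its denominator by (a - 1)^2.\<close>

lemma pochhammer_ratio_incseq:
  fixes a s :: real
  assumes "s > 0" "2 * a = s + 1"
  shows "incseq (\<lambda>k. (pochhammer a k)\<^sup>2 / (fact k * pochhammer s k))"
proof (rule incseq_SucI)
  fix k
  let ?u = "\<lambda>k. (pochhammer a k)\<^sup>2 / (fact k * pochhammer s k)"
  have "pochhammer s k > 0" using assms by (intro pochhammer_pos)
  then have u: "?u k \<ge> 0" by simp
  have pos: "(real k + 1) * (s + real k) > 0" using assms by (simp add: add_pos_nonneg)
  have "0 \<le> (a - 1)\<^sup>2" by simp
  also have "(a - 1)\<^sup>2 = (a + k)\<^sup>2 - (real k + 1) * (2 * a - 1 + k)"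
    by (simp add: power2_eq_square algebra_simps)
  also have "2 * a - 1 = s"
    using assms(2) by simp
  finally have "1 \<le> (a + k)\<^sup>2 / ((real k + 1) * (s + k))"
    using pos by (simp add: le_divide_eq)
  with u have "?u k * 1 \<le> ?u k * ((a + k)\<^sup>2 / ((real k + 1) * (s + k)))"
    by (rule mult_left_mono[rotated])
  also have "\<dots> = ?u (Suc k)"
    by (simp add: pochhammer_Suc power_mult_distrib mult_ac add_ac)
  finally show "?u k \<le> ?u (Suc k)" by simp
qed

lemma abel_mean_tendsto:
  fixes u :: "nat \<Rightarrow> real"
  assumes u: "u \<longlonglongrightarrow> L"
  shows "((\<lambda>x. (1 - x) * (\<Sum>k. u k * x ^ k)) \<longlongrightarrow> L) (at_left 1)"
proof -
  define d where "d k = u k - L" for k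
  have d: "d \<longlonglongrightarrow> 0" unfolding d_def using u by (rule LIM_zero)
  have "Bseq d" using d by (intro convergent_imp_Bseq) (auto simp: convergent_def)
  then obtain K where K: "\<And>k. \<bar>d k\<bar> \<le> K" by (auto simp: Bseq_def)
  have sd: "summable (\<lambda>k. \<bar>d k\<bar> * x ^ k)" if "0 \<le> x" "x < 1" for x
    using that K by (intro summable_comparison_test'[OF summable_mult[OF summable_geometric[of x]], of 0 _ K])
       (auto simp: abs_mult intro!: mult_right_mono)
  \<comment> \<open>The constant sequence \<open>L\<close> has Abel mean exactly \<open>L\<close>,
    by the geometric series; only the null sequence \<open>d\<close> remains.\<close>
  have eq: "(1 - x) * (\<Sum>k. u k * x ^ k) - L = (1 - x) * (\<Sum>k. d k * x ^ k)" if "0 \<le> x" "x < 1" for x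
  proof -
    have "summable (\<lambda>k. d k * x ^ k)"
      by (rule summable_norm_cancel) (use sd[OF that] that in \<open>simp add: abs_mult power_abs\<close>)
    then have "(\<lambda>k. d k * x ^ k + L * x ^ k) sums ((\<Sum>k. d k * x ^ k) + L * (1 / (1 - x)))"
      using that by (intro sums_add summable_sums sums_mult geometric_sums) auto
    then have "(\<Sum>k. u k * x ^ k) = (\<Sum>k. d k * x ^ k) + L * (1 / (1 - x))"
      by (simp add: d_def sums_iff algebra_simps)
    then show ?thesis using that by (simp add: distrib_left)
  qed
  have "((\<lambda>x. (1 - x) * (\<Sum>k. u k * x ^ k) - L) \<longlongrightarrow> 0) (at_left 1)"
  proof (rule tendstoI)
    fix e :: real assume e: "e > 0"
    obtain N where N: "\<And>k. k \<ge> N \<Longrightarrow> \<bar>d k\<bar> < e / 2"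
      using LIMSEQ_D[OF d, of "e / 2"] e by auto
    have "((\<lambda>x. (1 - x) * (\<Sum>k<N. \<bar>d k\<bar>)) \<longlongrightarrow> (1 - 1) * (\<Sum>k<N. \<bar>d k\<bar>)) (at_left 1)"
      by (intro tendsto_intros)
    then have "\<forall>\<^sub>F x in at_left 1. (1 - x) * (\<Sum>k<N. \<bar>d k\<bar>) < e / 2"
      using e by (intro order_tendstoD) auto
    moreover have "\<forall>\<^sub>F x in at_left 1. x \<in> {0<..<1::real}"
      by (rule eventually_at_leftI[of 0]) auto
    ultimately show "\<forall>\<^sub>F x in at_left 1. dist ((1 - x) * (\<Sum>k. u k * x ^ k) - L) 0 < e"
    proof eventually_elim
      case (elim x)
      then have x: "0 \<le> x" "x < 1" by auto
      have 1: "(\<lambda>k. if k < N then \<bar>d k\<bar> else 0) sums (\<Sum>k<N. \<bar>d k\<bar>)"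
        using sums_If_finite_set[of "{..<N}" "\<lambda>k. \<bar>d k\<bar>"] by simp
      have 2: "(\<lambda>k. e / 2 * x ^ k) sums (e / 2 * (1 / (1 - x)))"
        using x by (intro sums_mult geometric_sums) simp
      \<comment> \<open>The terms below \<open>N\<close> have a fixed finite sum, which the factor
        \<open>1 - x\<close> makes small. The rest is below a geometric series that this factor
        turns into \<open>e / 2\<close>.\<close>
      have "\<bar>\<Sum>k. d k * x ^ k\<bar> \<le> (\<Sum>k. \<bar>d k\<bar> * x ^ k)"
        using summable_rabs[of "\<lambda>k. d k * x ^ k"] sd[OF x] x by (simp add: abs_mult power_abs)
      also have "\<dots> \<le> (\<Sum>k. (if k < N then \<bar>d k\<bar> else 0) + e / 2 * x ^ k)"
      proof (intro suminf_le sd x)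
        fix k show "\<bar>d k\<bar> * x ^ k \<le> (if k < N then \<bar>d k\<bar> else 0) + e / 2 * x ^ k"
        proof (cases "k < N")
          case True
          have "\<bar>d k\<bar> * x ^ k \<le> \<bar>d k\<bar>" using x by (intro mult_left_le power_le_one) auto
          with True e x show ?thesis by (simp add: add_increasing2)
        next
          case False
          then have "\<bar>d k\<bar> * x ^ k \<le> e / 2 * x ^ k"
            using N[of k] x by (intro mult_right_mono) auto
          with False show ?thesis by simp
        qed
      qed (use 1 2 in \<open>auto simp: sums_iff intro: summable_add\<close>)
      also have "\<dots> = (\<Sum>k<N. \<bar>d k\<bar>) + e / 2 * (1 / (1 - x))"
        using sums_add[OF 1 2] by (simp add: sums_iff)
      finally have "(1 - x) * \<bar>\<Sum>k. d k * x ^ k\<bar> \<le> (1 - x) * ((\<Sum>k<N. \<bar>d k\<bar>) + e / 2 * (1 / (1 - x)))"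
        using x by (intro mult_left_mono) auto
      also have "\<dots> = (1 - x) * (\<Sum>k<N. \<bar>d k\<bar>) + e / 2"
        using x by (simp add: distrib_left divide_simps) (simp add: algebra_simps)
      also have "\<dots> < e" using elim by simp
      finally show ?case using x by (simp add: eq abs_mult)
    qed
  qed
  then show ?thesis by (rule LIM_zero_cancel)
qed

section \<open>The gradient of the Bergman projection\<close>

text \<open>First order Taylor expansion on the closed disc of radius \<open>r\<close>, where |1 -
  x| \<ge> 1 - r bounds the second derivative. The bound is uniform in \<open>x\<close> and
  \<open>y\<close>, so it survives integration in \<open>w\<close>.\<close>

lemma one_minus_powr_taylor:
  fixes x y :: complex
  assumes p: "p > 0" and r: "r < 1" and x: "norm x \<le> r" and y: "norm y \<le> r"
  shows "norm ((1 - y) powr (- complex_of_real p) - (1 - x) powr (- complex_of_real p)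
      - complex_of_real p * (1 - x) powr (- complex_of_real (p + 1)) * (y - x))
    \<le> p * (p + 1) * (1 - r) powr (- (p + 2)) * (norm (y - x))\<^sup>2"
proof -
  define f where "f i x = complex_of_real (pochhammer p i) * (1 - x) powr (- complex_of_real (p + real i))" for i and x :: complex
  \<comment> \<open>The complex Taylor estimate of order 1 divides by \<open>fact 1\<close> rather
    than \<open>fact 2\<close>, so no factor 1/2 appears.\<close>
  have "norm (f 0 y - (\<Sum>i\<le>1. f i x * (y - x) ^ i / fact i)) \<le>
      p * (p + 1) * (1 - r) powr (- (p + 2)) * norm (y - x) ^ Suc 1 / fact 1"
  proof (rule complex_Taylor[of "cball 0 r"])
    fix i and x :: complex assume x: "x \<in> cball 0 r"
    then have "Re x < 1" using complex_Re_le_cmod[of x] r by simp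
    then have "1 - x \<notin> \<real>\<^sub>\<le>\<^sub>0" by (auto simp: complex_nonpos_Reals_iff)
    then have "(f i has_field_derivative complex_of_real (pochhammer p i) *
        (- complex_of_real (p + real i) * (1 - x) powr (- complex_of_real (p + real i) - 1) * (- 1))) (at x)"
      unfolding f_def by (auto intro!: derivative_eq_intros)
    also have "complex_of_real (pochhammer p i) * (- complex_of_real (p + real i) * (1 - x) powr (- complex_of_real (p + real i) - 1) * (- 1)) = f (Suc i) x"
    proof -
      have e: "- complex_of_real (p + real i) - 1 = - complex_of_real (p + real (Suc i))" by simp
      show ?thesis
        unfolding e f_def pochhammer_Suc of_real_mult by (simp only: mult_ac mult_minus_left mult_minus_right minus_minus mult_1_right mult_1_left of_real_add of_real_of_nat_eq)
    qed
    finally show "(f i has_field_derivative f (Suc i) x) (at x within cball 0 r)"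
      by (rule has_field_derivative_at_within)
  next
    fix x :: complex assume "x \<in> cball 0 r"
    then have "1 - r \<le> norm (1 - x)"
      using norm_triangle_ineq2[of 1 x] by simp
    then have "norm (1 - x) powr (- (p + 2)) \<le> (1 - r) powr (- (p + 2))"
      using r p by (intro powr_mono2') auto
    then show "norm (f (Suc 1) x) \<le> p * (p + 1) * (1 - r) powr (- (p + 2))"
      using p by (simp add: f_def norm_mult norm_powr_real_powr' numeral_2_eq_2 pochhammer_Suc)
  qed (use x y in auto)
  then show ?thesis by (simp add: f_def algebra_simps power2_eq_square)
qed

text \<open>Hoelder's inequality for an essentially bounded \<open>g\<close> and a bounded
  continuous kernel.\<close>

lemma integral_Linf_mult:
  fixes g k :: "complex ^ 'n::finite \<Rightarrow> complex"
  assumes \<alpha>: "\<alpha> > -1" and g: "g \<in> borel_measurable (weighted_ball_measure \<alpha>)"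
    and M: "AE w in weighted_ball_measure \<alpha>. norm (g w) \<le> M" "M \<ge> 0"
    and k: "continuous_on unit_ball k" "\<And>w. w \<in> unit_ball \<Longrightarrow> norm (k w) \<le> C"
  shows "integrable (weighted_ball_measure \<alpha>) (\<lambda>w. g w * k w)"
    and "norm (\<integral>w. g w * k w \<partial>weighted_ball_measure \<alpha>) \<le> M * (\<integral>w. norm (k w) \<partial>weighted_ball_measure \<alpha>)"
proof -
  let ?\<mu> = "weighted_ball_measure \<alpha> :: (complex ^ 'n) measure"
  interpret finite_measure ?\<mu> using \<alpha> by (rule finite_measure_weighted_ball_measure)
  have ik: "integrable ?\<mu> (\<lambda>w. norm (k w))"
    using k by (intro integrable_norm integrable_weighted_ball_measureI[OF \<alpha>]) auto
  have km: "k \<in> borel_measurable ?\<mu>"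
    using k by (intro borel_measurable_weighted_ball_measureI)
  have AE: "AE w in ?\<mu>. norm (g w * k w) \<le> M * norm (k w)"
    using M(1) by eventually_elim (simp add: norm_mult mult_right_mono)
  show int: "integrable ?\<mu> (\<lambda>w. g w * k w)"
    by (rule Bochner_Integration.integrable_bound[OF integrable_mult_right[OF ik, of M]])
       (use g km AE M(2) in auto)
  have "norm (\<integral>w. g w * k w \<partial>?\<mu>) \<le> (\<integral>w. norm (g w * k w) \<partial>?\<mu>)"
    by (rule integral_norm_bound)
  also have "\<dots> \<le> (\<integral>w. M * norm (k w) \<partial>?\<mu>)"
    by (rule integral_mono_AE[OF integrable_norm[OF int] integrable_mult_right[OF ik, of M] AE])
  finally show "norm (\<integral>w. g w * k w \<partial>?\<mu>) \<le> M * (\<integral>w. norm (k w) \<partial>?\<mu>)" by simp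
qed

text \<open>The derivative of \<zeta> -> (1 - \<zeta>) powr (-p) at \<zeta> = <z,w>. By the chain
  rule, the i-th partial derivative of the kernel in \<open>z\<close> is this times
  \<open>cnj (w $ i)\<close>.\<close>

definition kernel_deriv :: "real \<Rightarrow> complex ^ 'n::finite \<Rightarrow> complex ^ 'n \<Rightarrow> complex"
  where "kernel_deriv p z w = complex_of_real p * (1 - cinner z w) powr (- complex_of_real (p + 1))"

lemma continuous_on_kernel_deriv [continuous_intros]:
  "norm z < 1 \<Longrightarrow> continuous_on unit_ball (kernel_deriv p z)"
  unfolding kernel_deriv_def[abs_def] by (intro continuous_intros)

lemma norm_kernel_deriv:
  "p > 0 \<Longrightarrow> norm (kernel_deriv p z w) = p * norm (1 - cinner z w) powr (- (p + 1))"
  by (simp add: kernel_deriv_def norm_mult norm_powr_real_powr')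

lemma norm_kernel_deriv_le:
  "norm z < 1 \<Longrightarrow> w \<in> unit_ball \<Longrightarrow> p > 0 \<Longrightarrow> norm (kernel_deriv p z w) \<le> p * (1 - norm z) powr (- (p + 1))"
  unfolding norm_kernel_deriv using norm_one_minus_cinner_powr_le[of z w "p + 1"] by simp

text \<open>The Taylor remainder of the kernel is O(|y - z|^2) uniformly in \<open>w\<close>, so it
  can be integrated against \<open>g\<close> directly. The coordinate form in the second claim
  exhibits linearity.\<close>

lemma has_derivative_bergman_projection:
  fixes g :: "complex ^ 'n::finite \<Rightarrow> complex" and z
  assumes \<alpha>: "\<alpha> > -1" and g: "g \<in> borel_measurable (weighted_ball_measure \<alpha>)"
    and M: "AE w in weighted_ball_measure \<alpha>. norm (g w) \<le> M" "M \<ge> 0"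
    and z: "z \<in> unit_ball"
  defines "p \<equiv> real CARD('n) + 1 + \<alpha>"
  shows "(bergman_projection \<alpha> g has_derivative
      (\<lambda>v. \<integral>w. g w * (kernel_deriv p z w * cinner v w) \<partial>weighted_ball_measure \<alpha>)) (at z)"
    and "(\<integral>w. g w * (kernel_deriv p z w * cinner v w) \<partial>weighted_ball_measure \<alpha>) =
      (\<Sum>i\<in>UNIV. v $ i * (\<integral>w. g w * (kernel_deriv p z w * cnj (w $ i)) \<partial>weighted_ball_measure \<alpha>))"
proof -
  let ?\<mu> = "weighted_ball_measure \<alpha> :: (complex ^ 'n) measure"
  interpret finite_measure ?\<mu> using \<alpha> by (rule finite_measure_weighted_ball_measure)
  have p: "p > 0" using \<alpha> by (simp add: p_def add_nonneg_pos)
  have z1: "norm z < 1" using z by simp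
  define f' where "f' v = (\<integral>w. g w * (kernel_deriv p z w * cinner v w) \<partial>?\<mu>)" for v
  have int_i: "integrable ?\<mu> (\<lambda>w. g w * (kernel_deriv p z w * cnj (w $ i)))" for i
  proof (rule integral_Linf_mult[OF \<alpha> g M])
    show "norm (kernel_deriv p z w * cnj (w $ i)) \<le> p * (1 - norm z) powr (- (p + 1)) * 1" if "w \<in> unit_ball" for w
      unfolding norm_mult complex_mod_cnj
      using norm_kernel_deriv_le[OF z1 that p] Finite_Cartesian_Product.norm_nth_le[of w i] that p
      by (intro mult_mono) auto
  qed (auto intro!: continuous_intros z1)
  have int_v: "integrable ?\<mu> (\<lambda>w. g w * (kernel_deriv p z w * cinner v w))" for v
  proof (rule integral_Linf_mult[OF \<alpha> g M])
    show "norm (kernel_deriv p z w * cinner v w) \<le> p * (1 - norm z) powr (- (p + 1)) * (norm v * 1)" if "w \<in> unit_ball" for w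
      unfolding norm_mult
      using norm_kernel_deriv_le[OF z1 that p] norm_cinner_le[of v w] mult_left_mono[of "norm w" 1 "norm v"] that p
      by (intro mult_mono) auto
  qed (auto intro!: continuous_intros z1)
  show sum: "(\<integral>w. g w * (kernel_deriv p z w * cinner v w) \<partial>?\<mu>) =
      (\<Sum>i\<in>UNIV. v $ i * (\<integral>w. g w * (kernel_deriv p z w * cnj (w $ i)) \<partial>?\<mu>))" for v
  proof -
    have "(\<integral>w. g w * (kernel_deriv p z w * cinner v w) \<partial>?\<mu>) =
        (\<integral>w. (\<Sum>i\<in>UNIV. v $ i * (g w * (kernel_deriv p z w * cnj (w $ i)))) \<partial>?\<mu>)"
      by (simp add: cinner_def sum_distrib_left mult_ac)
    also have "\<dots> = (\<Sum>i\<in>UNIV. v $ i * (\<integral>w. g w * (kernel_deriv p z w * cnj (w $ i)) \<partial>?\<mu>))"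
      using int_i by (subst Bochner_Integration.integral_sum) auto
    finally show ?thesis .
  qed
  have lin: "linear f'"
    unfolding f'_def sum by (rule linearI) (simp_all add: distrib_right sum.distrib scaleR_sum_right)
  \<comment> \<open>The midpoint between |z| and 1: a neighbourhood of \<open>z\<close> lies in the
    ball of radius \<open>r\<close>, where the remainder estimate has a single constant.\<close>
  define r where "r = (1 + norm z) / 2"
  have r: "norm z < r" "r < 1" using z1 by (simp_all add: r_def)
  define K where "K = p * (p + 1) * (1 - r) powr (- (p + 2))"
  have K: "K \<ge> 0" using p by (simp add: K_def)
  have P: "bergman_projection \<alpha> g y = (\<integral>w. g w * (1 - cinner y w) powr (- complex_of_real p) \<partial>?\<mu>)" for y
    by (simp only: bergman_projection_def p_def powr_minus divide_inverse)
  have int_P: "integrable ?\<mu> (\<lambda>w. g w * (1 - cinner y w) powr (- complex_of_real p))" if y: "norm y < 1" for y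
  proof (rule integral_Linf_mult[OF \<alpha> g M])
    show "norm ((1 - cinner y w) powr (- complex_of_real p)) \<le> (1 - norm y) powr (- p)" if "w \<in> unit_ball" for w
      using norm_one_minus_cinner_powr_le[OF y that, of p] p by (simp add: norm_powr_real_powr')
  qed (auto intro!: continuous_intros y)
  have rem: "norm (bergman_projection \<alpha> g y - bergman_projection \<alpha> g z - f' (y - z)) \<le> M * (K * (norm (y - z))\<^sup>2)"
    if y: "norm y \<le> r" for y
  proof -
    define R where "R w = (1 - cinner y w) powr (- complex_of_real p) - (1 - cinner z w) powr (- complex_of_real p)
      - kernel_deriv p z w * cinner (y - z) w" for w
    have y1: "norm y < 1" using y r by simp
    have Rc: "continuous_on unit_ball R"
      unfolding R_def by (intro continuous_intros y1 z1)
    have Rb: "norm (R w) \<le> K * (norm (y - z))\<^sup>2" if w: "w \<in> unit_ball" for w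
    proof -
      have le: "norm (cinner v w) \<le> norm v" for v :: "complex ^ 'n"
        using norm_cinner_le[of v w] mult_left_mono[of "norm w" 1 "norm v"] w by simp
      have d: "cinner (y - z) w = cinner y w - cinner z w"
        by (simp add: cinner_def algebra_simps sum_subtractf)
      have "norm (R w) \<le> K * (norm (cinner y w - cinner z w))\<^sup>2"
        unfolding R_def d kernel_deriv_def K_def
        using le[of y] le[of z] y r by (intro one_minus_powr_taylor p) auto
      also have "\<dots> \<le> K * (norm (y - z))\<^sup>2"
        using le[of "y - z"] K by (intro mult_left_mono power_mono) (auto simp: d)
      finally show ?thesis .
    qed
    have "bergman_projection \<alpha> g y - bergman_projection \<alpha> g z - f' (y - z) = (\<integral>w. g w * R w \<partial>?\<mu>)"
      unfolding P f'_def R_def using int_P[OF y1] int_P[OF z1] int_v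
      by (simp add: right_diff_distrib flip: Bochner_Integration.integral_diff)
    also have "norm \<dots> \<le> M * (\<integral>w. norm (R w) \<partial>?\<mu>)"
      by (rule integral_Linf_mult(2)[OF \<alpha> g M Rc Rb])
    also have "(\<integral>w. norm (R w) \<partial>?\<mu>) \<le> (\<integral>w. K * (norm (y - z))\<^sup>2 \<partial>?\<mu>)"
      using Rb by (intro integral_mono integrable_norm integrable_weighted_ball_measureI[OF \<alpha> Rc Rb]) auto
    also have "\<dots> = K * (norm (y - z))\<^sup>2"
      using emeasure_weighted_ball_measure_space[OF \<alpha>, where 'n='n] by (simp add: measure_def)
    finally show ?thesis using M(2) by (simp add: mult_left_mono)
  qed
  have "(bergman_projection \<alpha> g has_derivative f') (at z)"
  proof (rule has_derivativeI_sandwich[of "r - norm z" _ _ _ _ "\<lambda>y. M * K * norm (y - z)"])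
    show "r - norm z > 0" using r by simp
    show "bounded_linear f'" using lin by (simp add: linear_conv_bounded_linear)
    have "((\<lambda>y. M * K * norm (y - z)) \<longlongrightarrow> M * K * norm (z - z)) (at z)"
      by (intro tendsto_intros)
    then show "((\<lambda>y. M * K * norm (y - z)) \<longlongrightarrow> 0) (at z)" by simp
    fix y assume "y \<noteq> z" "dist y z < r - norm z"
    then have "norm y \<le> r" using norm_triangle_ineq2[of y z] by (simp add: dist_norm)
    from rem[OF this] \<open>y \<noteq> z\<close>
    show "norm (bergman_projection \<alpha> g y - bergman_projection \<alpha> g z - f' (y - z)) / norm (y - z) \<le> M * K * norm (y - z)"
      by (simp add: divide_le_eq power2_eq_square mult.assoc)
  qed
  then show "(bergman_projection \<alpha> g has_derivative
      (\<lambda>v. \<integral>w. g w * (kernel_deriv p z w * cinner v w) \<partial>?\<mu>)) (at z)"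
    by (simp add: f'_def[abs_def])
qed

text \<open>Along the i-th axis, complex linearity turns the real derivative into multiplication by
  a complex number, hence into a complex derivative.\<close>

lemma cgrad_nth_eq:
  fixes f :: "complex ^ 'a::finite \<Rightarrow> complex"
  assumes "(f has_derivative f') (at z)"
    and lin: "\<And>c v. f' (c *s v) = c * f' v"
  shows "cgrad f z $ i = f' (axis i 1)"
proof -
  have ax: "axis i \<zeta> = \<zeta> *s axis i (1::complex)" for \<zeta>
    by (simp add: vec_eq_iff axis_def)
  have "((\<lambda>\<zeta>. z + axis i \<zeta>) has_derivative (\<lambda>\<zeta>. axis i \<zeta>)) (at 0)"
  proof -
    have "linear (\<lambda>\<zeta>. axis i \<zeta> :: complex ^ 'a)"
      by (rule linearI) (simp_all add: axis_def vec_eq_iff)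
    then have "((\<lambda>\<zeta>. axis i \<zeta>) has_derivative (\<lambda>\<zeta>. axis i \<zeta> :: complex ^ 'a)) (at 0)"
      by (intro bounded_linear_imp_has_derivative) (simp add: linear_conv_bounded_linear)
    from has_derivative_add[OF has_derivative_const this] show ?thesis by simp
  qed
  moreover have ax0: "axis i 0 = (0 :: complex ^ 'a)"
    by (simp add: axis_def vec_eq_iff)
  ultimately have "((\<lambda>\<zeta>. f (z + axis i \<zeta>)) has_derivative (\<lambda>\<zeta>. f' (axis i \<zeta>))) (at 0)"
    using assms(1) by (intro has_derivative_compose[of "\<lambda>\<zeta>. z + axis i \<zeta>" _ 0 UNIV f f']) (auto simp: ax0)
  moreover have "(\<lambda>\<zeta>. f' (axis i \<zeta>)) = (*) (f' (axis i 1))"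
    by (rule ext, subst ax) (simp only: lin mult.commute)
  ultimately have "((\<lambda>\<zeta>. f (z + axis i \<zeta>)) has_field_derivative f' (axis i 1)) (at 0)"
    unfolding has_field_derivative_def by (simp only:)
  then show ?thesis
    by (simp add: cgrad_def DERIV_imp_deriv)
qed


text \<open>For the norm bound all partial derivatives are treated together through <v,w>, whose
  modulus is at most |v| on the ball; thus no dimensional factor is lost.\<close>

lemma bergman_projection_gradient:
  fixes g :: "complex ^ 'n::finite \<Rightarrow> complex" and z
  assumes \<alpha>: "\<alpha> > -1" and g: "g \<in> borel_measurable (weighted_ball_measure \<alpha>)"
    and M: "AE w in weighted_ball_measure \<alpha>. norm (g w) \<le> M" "M \<ge> 0"
    and z: "z \<in> unit_ball"
  defines "p \<equiv> real CARD('n) + 1 + \<alpha>"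
  shows "\<exists>f'. (bergman_projection \<alpha> g has_derivative f') (at z) \<and> (\<forall>c v. f' (c *s v) = c * f' v)"
    and "cgrad (bergman_projection \<alpha> g) z $ i =
      (\<integral>w. g w * (kernel_deriv p z w * cnj (w $ i)) \<partial>weighted_ball_measure \<alpha>)"
    and "norm (cgrad (bergman_projection \<alpha> g) z) \<le>
      M * (p * (\<integral>w. norm (1 - cinner z w) powr (- (p + 1)) \<partial>weighted_ball_measure \<alpha>))"
proof -
  let ?\<mu> = "weighted_ball_measure \<alpha> :: (complex ^ 'n) measure"
  have p: "p > 0" using \<alpha> by (simp add: p_def add_nonneg_pos)
  have z1: "norm z < 1" using z by simp
  define D where "D i = (\<integral>w. g w * (kernel_deriv p z w * cnj (w $ i)) \<partial>?\<mu>)" for i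
  define f' where "f' v = (\<integral>w. g w * (kernel_deriv p z w * cinner v w) \<partial>?\<mu>)" for v
  have d: "(bergman_projection \<alpha> g has_derivative f') (at z)" and f': "f' v = (\<Sum>i\<in>UNIV. v $ i * D i)" for v
    using has_derivative_bergman_projection[OF \<alpha> g M z] unfolding f'_def[abs_def] D_def p_def by auto
  have lin: "f' (c *s v) = c * f' v" for c v
    by (simp add: f' sum_distrib_left mult.assoc)
  show "\<exists>f'. (bergman_projection \<alpha> g has_derivative f') (at z) \<and> (\<forall>c v. f' (c *s v) = c * f' v)"
    using d lin by blast
  show *: "cgrad (bergman_projection \<alpha> g) z $ i = (\<integral>w. g w * (kernel_deriv p z w * cnj (w $ i)) \<partial>?\<mu>)" for i
  proof -
    have "cgrad (bergman_projection \<alpha> g) z $ i = f' (axis i 1)"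
      using d lin by (rule cgrad_nth_eq)
    also have "\<dots> = (\<Sum>j\<in>UNIV. if j = i then D i else 0)"
      unfolding f' by (intro sum.cong) (auto simp: axis_def)
    also have "\<dots> = D i" by simp
    finally show ?thesis by (simp add: D_def)
  qed
  text \<open>The norm of the gradient is attained by pairing with its conjugate, which keeps all integrals scalar.\<close>
  define N where "N = norm (cgrad (bergman_projection \<alpha> g) z)"
  define I where "I = (\<integral>w. norm (1 - cinner z w) powr (- (p + 1)) \<partial>?\<mu>)"
  define v :: "complex ^ 'n" where "v = (\<chi> i. cnj (D i))"
  have cg: "cgrad (bergman_projection \<alpha> g) z = (\<chi> i. D i)"
    by (simp add: vec_eq_iff * D_def)
  have Nv: "N = norm v"
    by (simp add: N_def cg v_def norm_vec_def)
  have fv: "f' v = complex_of_real (N\<^sup>2)"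
    using cinner_self[of v] by (simp add: f' Nv cinner_def v_def)
  have bound: "norm (kernel_deriv p z w * cinner v w) \<le> p * norm (1 - cinner z w) powr (- (p + 1)) * N"
    if "w \<in> unit_ball" for w
    unfolding norm_mult norm_kernel_deriv[OF p] Nv
    using norm_cinner_le[of v w] mult_left_mono[of "norm w" 1 "norm v"] that p
    by (intro mult_left_mono) auto
  have bound': "p * norm (1 - cinner z w) powr (- (p + 1)) \<le> p * (1 - norm z) powr (- (p + 1))"
    if "w \<in> unit_ball" for w
    using norm_one_minus_cinner_powr_le[OF z1 that, of "p + 1"] p by simp
  have cont: "continuous_on unit_ball (\<lambda>w. kernel_deriv p z w * cinner v w)"
    by (intro continuous_intros z1)
  have cont_pow: "continuous_on unit_ball (\<lambda>w. norm (1 - cinner z w) powr (- (p + 1)))"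
    using norm_one_minus_cinner_ge(3)[OF z1] by (intro continuous_intros) force+
  have "N\<^sup>2 = norm (f' v)" by (simp add: fv norm_power)
  also have "\<dots> \<le> M * (\<integral>w. norm (kernel_deriv p z w * cinner v w) \<partial>?\<mu>)"
    unfolding f'_def
  proof (rule integral_Linf_mult(2)[OF \<alpha> g M cont])
    fix w :: "complex ^ 'n" assume "w \<in> unit_ball"
    from bound[OF this] bound'[OF this]
    show "norm (kernel_deriv p z w * cinner v w) \<le> p * (1 - norm z) powr (- (p + 1)) * N"
      by (rule order_trans[OF _ mult_right_mono]) (simp add: N_def)
  qed
  also have "\<dots> \<le> M * (\<integral>w. p * norm (1 - cinner z w) powr (- (p + 1)) * N \<partial>?\<mu>)"
  proof (rule mult_left_mono[OF integral_mono M(2)])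
    show "integrable ?\<mu> (\<lambda>w. p * norm (1 - cinner z w) powr (- (p + 1)) * N)"
    proof (rule integrable_weighted_ball_measureI[OF \<alpha>])
      fix w :: "complex ^ 'n" assume "w \<in> unit_ball"
      from mult_right_mono[OF bound'[OF this], of N]
      show "norm (p * norm (1 - cinner z w) powr (- (p + 1)) * N) \<le> p * (1 - norm z) powr (- (p + 1)) * N"
        using p by (simp add: N_def abs_mult)
    qed (intro continuous_intros cont_pow)
    show "integrable ?\<mu> (\<lambda>w. norm (kernel_deriv p z w * cinner v w))"
    proof (rule integrable_norm[OF integrable_weighted_ball_measureI[OF \<alpha> cont]])
      fix w :: "complex ^ 'n" assume "w \<in> unit_ball"
      from bound[OF this] bound'[OF this]
      show "norm (kernel_deriv p z w * cinner v w) \<le> p * (1 - norm z) powr (- (p + 1)) * N"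
        by (rule order_trans[OF _ mult_right_mono]) (simp add: N_def)
    qed
  qed (use bound in auto)
  also have "(\<integral>w. p * norm (1 - cinner z w) powr (- (p + 1)) * N \<partial>?\<mu>) = p * I * N"
    by (simp add: I_def)
  finally have "N * N \<le> (M * (p * I)) * N"
    by (simp add: power2_eq_square mult_ac)
  moreover have "I \<ge> 0" unfolding I_def by (intro integral_nonneg_AE) auto
  \<comment> \<open>One factor \<open>N\<close> cancels; for \<open>N = 0\<close> the claim is that
    the right-hand side is nonnegative.\<close>
  ultimately have "N \<le> M * (p * I)"
    using p M(2) by (cases "N = 0") (auto simp: N_def)
  then show "norm (cgrad (bergman_projection \<alpha> g) z) \<le> M * (p * I)"
    by (simp add: N_def)
qed


text \<open>\<open>Linf_norm\<close> refers to the unweighted measure; its null sets stay null under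
  a density.\<close>

lemma AE_weighted_ball_measure:
  assumes "AE w in (ball_measure :: (complex ^ 'n::finite) measure). Q w"
  shows "AE w in (weighted_ball_measure \<alpha> :: (complex ^ 'n) measure). Q w"
proof -
  have "(\<lambda>z :: complex ^ 'n. ennreal (ball_const CARD('n) \<alpha> * (1 - (norm z)\<^sup>2) powr \<alpha>)) \<in> borel_measurable ball_measure"
    by (rule measurable_weighted_ball_measure_borel) measurable
  moreover have "AE w in (ball_measure :: (complex ^ 'n) measure).
      0 < ennreal (ball_const CARD('n) \<alpha> * (1 - (norm w)\<^sup>2) powr \<alpha>) \<longrightarrow> Q w"
    using assms by eventually_elim simp
  ultimately show ?thesis
    unfolding weighted_ball_measure_def by (subst AE_density)
qed

section \<open>The seminorm\<close>

text \<open>\<open>p\<close> is the exponent of the Bergman kernel and \<open>L\<close> the limit of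
  the coefficients for exponent \<open>p + 1\<close>; the norm will be \<open>p * L\<close>. The
  argument \<open>dim\<close> fixes the type whose cardinality is n.\<close>

context
  fixes \<alpha> :: real and p L and dim :: "'n::finite itself"
  assumes \<alpha>: "\<alpha> > -1"
  defines "p \<equiv> real CARD('n) + 1 + \<alpha>"
  defines "L \<equiv> Gamma p / (Gamma ((p + 1) / 2))\<^sup>2"
begin

lemma exponent_pos: "p > 0"
  using \<alpha> by (simp add: p_def add_nonneg_pos)

lemma kernel_integral_sums:
  fixes z :: "complex ^ 'n"
  assumes z: "norm z < 1" and q: "q > 0"
  shows "(\<lambda>k. (pochhammer (q / 2) k)\<^sup>2 / (fact k * pochhammer p k) * (norm z)\<^sup>2 ^ k) sums
    (\<integral>w. norm (1 - cinner z w) powr (- q) \<partial>weighted_ball_measure \<alpha>)"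
  using forelli_rudin_sums[OF \<alpha> z, of "q / 2"] q by (simp add: p_def)

text \<open>All coefficients lie below their limit \<open>L\<close>, so the series lies below the
  geometric series L / (1 - |z|^2).\<close>

lemma kernel_integral_le:
  fixes z :: "complex ^ 'n"
  assumes z: "norm z < 1"
  shows "(1 - (norm z)\<^sup>2) * (\<integral>w. norm (1 - cinner z w) powr (- (p + 1)) \<partial>weighted_ball_measure \<alpha>) \<le> L"
proof -
  define u where "u k = (pochhammer ((p + 1) / 2) k)\<^sup>2 / (fact k * pochhammer p k)" for k
  define x where "x = (norm z)\<^sup>2"
  have x: "0 \<le> x" "x < 1" using z by (simp_all add: x_def power_less_one_iff)
  have "incseq u" "u \<longlonglongrightarrow> L"
    using pochhammer_ratio_incseq[of p "(p + 1) / 2"] pochhammer_ratio_LIMSEQ(1)[of "(p + 1) / 2" p] exponent_pos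
    unfolding u_def[abs_def] L_def by auto
  then have uL: "u k \<le> L" for k by (rule incseq_le)
  have "(\<lambda>k. u k * x ^ k) sums (\<integral>w. norm (1 - cinner z w) powr (- (p + 1)) \<partial>weighted_ball_measure \<alpha>)"
    using kernel_integral_sums[OF z, of "p + 1"] exponent_pos by (simp add: u_def x_def)
  moreover have "(\<lambda>k. L * x ^ k) sums (L * (1 / (1 - x)))"
    using x by (intro sums_mult geometric_sums) simp
  ultimately have "(\<integral>w. norm (1 - cinner z w) powr (- (p + 1)) \<partial>weighted_ball_measure \<alpha>) \<le> L * (1 / (1 - x))"
    by (rule sums_le[rotated]) (use uL x in \<open>auto intro: mult_right_mono\<close>)
  then show ?thesis using x by (simp add: x_def[symmetric] pos_le_divide_eq mult.commute)
qed

text \<open>A general \<open>M\<close> serves membership in the Bloch space, \<open>M = 1\<close>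
  the operator seminorm.\<close>

lemma bloch_seminorm_bergman_projection_le:
  fixes g :: "complex ^ 'n \<Rightarrow> complex"
  assumes g: "g \<in> borel_measurable ball_measure" and gM: "Linf_norm g \<le> ereal M" and M: "M \<ge> 0"
  shows "bloch_seminorm (bergman_projection \<alpha> g) \<le> ereal (M * (p * L))"
    and "cn_holomorphic_on (bergman_projection \<alpha> g) unit_ball"
proof -
  have gm: "g \<in> borel_measurable (weighted_ball_measure \<alpha>)"
    using g by (simp add: weighted_ball_measure_def)
  have "AE w in ball_measure. ereal (norm (g w)) \<le> Linf_norm g"
    unfolding Linf_norm_def by (rule esssup_AE)
  then have "AE w in ball_measure. norm (g w) \<le> M"
    by eventually_elim (use gM in \<open>metis ereal_less_eq(3) order_trans\<close>)
  then have AE: "AE w in weighted_ball_measure \<alpha>. norm (g w) \<le> M"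
    by (rule AE_weighted_ball_measure)
  show "cn_holomorphic_on (bergman_projection \<alpha> g) unit_ball"
    unfolding cn_holomorphic_on_def using bergman_projection_gradient(1)[OF \<alpha> gm AE M] by blast
  show "bloch_seminorm (bergman_projection \<alpha> g) \<le> ereal (M * (p * L))"
    unfolding bloch_seminorm_def
  proof (rule SUP_least)
    fix z :: "complex ^ 'n" assume z: "z \<in> unit_ball"
    then have z1: "norm z < 1" "(norm z)\<^sup>2 < 1" by (simp_all add: power_less_one_iff)
    let ?I = "\<integral>w. norm (1 - cinner z w) powr (- (p + 1)) \<partial>weighted_ball_measure \<alpha>"
    have "(1 - (norm z)\<^sup>2) * norm (cgrad (bergman_projection \<alpha> g) z) \<le> (1 - (norm z)\<^sup>2) * (M * (p * ?I))"
      using bergman_projection_gradient(3)[OF \<alpha> gm AE M z] z1 by (intro mult_left_mono) (auto simp: p_def)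
    also have "\<dots> = M * (p * ((1 - (norm z)\<^sup>2) * ?I))" by simp
    also have "\<dots> \<le> M * (p * L)"
      using kernel_integral_le[OF z1(1)] M exponent_pos by (intro mult_left_mono) auto
    finally show "ereal ((1 - (norm z)\<^sup>2) * norm (cgrad (bergman_projection \<alpha> g) z)) \<le> ereal (M * (p * L))"
      by simp
  qed
qed

text \<open>The function \<open>g\<close> is adapted to one point \<open>z\<close> with |z|^2 = x;
  the two series are the kernel integrals with exponents \<open>p + 1\<close> and
  \<open>p\<close>.\<close>

lemma bloch_seminorm_bergman_projection_ge:
  assumes x: "0 < x" "x < 1"
  shows "\<exists>g :: complex ^ 'n \<Rightarrow> complex. g \<in> Linf \<and> Linf_norm g \<le> 1 \<and>
    ereal (p * ((1 - x) * (\<Sum>k. (pochhammer ((p + 1) / 2) k)\<^sup>2 / (fact k * pochhammer p k) * x ^ k) -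
      (1 - x) * (\<Sum>k. (pochhammer (p / 2) k)\<^sup>2 / (fact k * pochhammer p k) * x ^ k)))
    \<le> bloch_seminorm (bergman_projection \<alpha> g)"
proof -
  let ?\<mu> = "weighted_ball_measure \<alpha> :: (complex ^ 'n) measure"
  obtain i :: 'n where True by simp
  define z :: "complex ^ 'n" where "z = axis i (complex_of_real (sqrt x))"
  have nz: "(norm z)\<^sup>2 = x"
  proof -
    have "(norm z)\<^sup>2 = (\<Sum>j\<in>UNIV. (norm (z $ j))\<^sup>2)"
      by (simp add: norm_vec_def L2_set_def sum_nonneg)
    also have "\<dots> = (\<Sum>j\<in>UNIV. if j = i then x else 0)"
      using x by (intro sum.cong) (auto simp: z_def axis_def)
    finally show ?thesis by simp
  qed
  have z1: "norm z < 1" using nz x by (metis abs_norm_cancel abs_square_less_1)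
  then have z: "z \<in> unit_ball" by simp
  \<comment> \<open>As \<open>z\<close> lies on the i-th axis, <z,w> involves only
    \<open>w $ i\<close>.\<close>
  have cz: "norm (cinner z w) \<le> norm (w $ i)" for w
  proof -
    have "cinner z w = (\<Sum>j\<in>UNIV. if j = i then complex_of_real (sqrt x) * cnj (w $ i) else 0)"
      unfolding cinner_def z_def by (intro sum.cong) (auto simp: axis_def)
    then have "norm (cinner z w) = sqrt x * norm (w $ i)"
      using x by (simp add: norm_mult)
    also have "\<dots> \<le> norm (w $ i)" using x by (intro mult_left_le_one_le) auto
    finally show ?thesis .
  qed
  define X where "X w = kernel_deriv p z w * cnj (w $ i)" for w
  \<comment> \<open>The conjugate phase of the kernel \<open>X\<close>, so that
    \<open>g w * X w\<close> is |X w|; \<open>sgn 0 = 0\<close> covers the zeros of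
    \<open>X\<close>.\<close>
  define g where "g w = cnj (sgn (X w))" for w
  have Xc: "continuous_on unit_ball X"
    unfolding X_def by (intro continuous_intros z1)
  have Xm: "X \<in> borel_measurable ?\<mu>"
    using Xc by (rule borel_measurable_weighted_ball_measureI)
  then have Xm': "X \<in> borel_measurable ball_measure"
    by (simp add: weighted_ball_measure_def)
  have gm: "g \<in> borel_measurable ball_measure"
  proof -
    have "(\<lambda>w. sgn (X w)) \<in> borel_measurable ball_measure"
      unfolding sgn_div_norm using Xm' by measurable
    then show ?thesis
      unfolding g_def by (rule measurable_compose) (intro borel_measurable_continuous_onI continuous_intros)
  qed
  then have gm': "g \<in> borel_measurable ?\<mu>"
    by (simp add: weighted_ball_measure_def)
  have g1: "norm (g w) \<le> 1" for w
    by (simp add: g_def norm_sgn)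
  have "Linf_norm g \<le> 1"
    unfolding Linf_norm_def one_ereal_def using gm g1 by (intro esssup_I) auto
  moreover from this gm have "g \<in> Linf"
    by (auto simp: Linf_def intro: le_less_trans)
  moreover have "ereal (p * ((1 - x) * (\<Sum>k. (pochhammer ((p + 1) / 2) k)\<^sup>2 / (fact k * pochhammer p k) * x ^ k) -
      (1 - x) * (\<Sum>k. (pochhammer (p / 2) k)\<^sup>2 / (fact k * pochhammer p k) * x ^ k)))
    \<le> bloch_seminorm (bergman_projection \<alpha> g)"
  proof -
    let ?I = "\<lambda>q. \<integral>w. norm (1 - cinner z w) powr (- q) \<partial>?\<mu>"
    have I1: "?I (p + 1) = (\<Sum>k. (pochhammer ((p + 1) / 2) k)\<^sup>2 / (fact k * pochhammer p k) * x ^ k)"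
      using kernel_integral_sums[OF z1, of "p + 1"] exponent_pos by (simp add: nz sums_iff)
    have I2: "?I p = (\<Sum>k. (pochhammer (p / 2) k)\<^sup>2 / (fact k * pochhammer p k) * x ^ k)"
      using kernel_integral_sums[OF z1, of p] exponent_pos by (simp add: nz sums_iff)
    have int: "integrable ?\<mu> (\<lambda>w. norm (1 - cinner z w) powr (- q))" if "q \<ge> 0" for q
    proof (rule integrable_weighted_ball_measureI[OF \<alpha>])
      show "continuous_on unit_ball (\<lambda>w. norm (1 - cinner z w) powr (- q))"
        using norm_one_minus_cinner_ge(3)[OF z1] by (intro continuous_intros) force+
      show "norm (norm (1 - cinner z w) powr (- q)) \<le> (1 - norm z) powr (- q)" if "w \<in> unit_ball" for w
        using norm_one_minus_cinner_powr_le[OF z1 that \<open>q \<ge> 0\<close>] by simp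
    qed
    have "p * (?I (p + 1) - ?I p) = (\<integral>w. p * (norm (1 - cinner z w) powr (- (p + 1)) - norm (1 - cinner z w) powr (- p)) \<partial>?\<mu>)"
      using int[of "p + 1"] int[of p] exponent_pos by simp
    also have "\<dots> \<le> (\<integral>w. norm (X w) \<partial>?\<mu>)"
    proof (rule integral_mono)
      show "integrable ?\<mu> (\<lambda>w. p * (norm (1 - cinner z w) powr (- (p + 1)) - norm (1 - cinner z w) powr (- p)))"
        using int[of "p + 1"] int[of p] exponent_pos by simp
      show "integrable ?\<mu> (\<lambda>w. norm (X w))"
      proof (rule integrable_norm[OF integrable_weighted_ball_measureI[OF \<alpha> Xc]])
        fix w :: "complex ^ 'n" assume w: "w \<in> unit_ball"
        show "norm (X w) \<le> p * (1 - norm z) powr (- (p + 1)) * 1"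
          unfolding X_def norm_mult complex_mod_cnj
          using norm_kernel_deriv_le[OF z1 w exponent_pos] Finite_Cartesian_Product.norm_nth_le[of w i] w exponent_pos
          by (intro mult_mono) auto
      qed
      fix w assume "w \<in> space ?\<mu>"
      then have w: "w \<in> unit_ball" by simp
      let ?d = "norm (1 - cinner z w)"
      \<comment> \<open>The factor |w_i| in |X w| is bounded below by 1 - |1 - <z,w>|, since 1 - |1
        - <z,w>| \<le> |<z,w>| \<le> |w_i|. The subtracted term lowers the kernel exponent by
        one.\<close>
      have d: "?d > 0" "1 - ?d \<le> norm (w $ i)"
        using norm_one_minus_cinner_ge[OF z1 w] cz[of w] by auto
      have "?d powr (- p) = ?d powr (- (p + 1)) * ?d"
        using d powr_add[of ?d "- (p + 1)" 1] by simp
      then have "p * (?d powr (- (p + 1)) - ?d powr (- p)) = p * ?d powr (- (p + 1)) * (1 - ?d)"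
        by (simp add: algebra_simps)
      also have "\<dots> \<le> p * ?d powr (- (p + 1)) * norm (w $ i)"
        using d exponent_pos by (intro mult_left_mono) auto
      also have "\<dots> = norm (X w)"
        by (simp only: X_def norm_mult norm_kernel_deriv[OF exponent_pos] complex_mod_cnj)
      finally show "p * (?d powr (- (p + 1)) - ?d powr (- p)) \<le> norm (X w)" .
    qed
    also have "\<dots> = norm (\<integral>w. complex_of_real (norm (X w)) \<partial>?\<mu>)"
      by (simp add: integral_nonneg_AE)
    also have "(\<integral>w. complex_of_real (norm (X w)) \<partial>?\<mu>) = (\<integral>w. g w * X w \<partial>?\<mu>)"
    proof (rule Bochner_Integration.integral_cong[OF refl])
      fix w
      have "g w * X w = complex_of_real (inverse (norm (X w))) * (X w * cnj (X w))"
        by (simp add: g_def sgn_div_norm scaleR_conv_of_real)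
      also have "\<dots> = complex_of_real (inverse (norm (X w)) * (norm (X w))\<^sup>2)"
        by (simp only: complex_norm_square of_real_mult)
      also have "inverse (norm (X w)) * (norm (X w))\<^sup>2 = norm (X w)"
        by (cases "X w = 0") (simp_all add: power2_eq_square)
      finally show "complex_of_real (norm (X w)) = g w * X w" by simp
    qed
    also have "\<dots> = cgrad (bergman_projection \<alpha> g) z $ i"
      using bergman_projection_gradient(2)[OF \<alpha> gm' _ _ z, of 1 i] g1 by (simp add: X_def p_def)
    also have "norm \<dots> \<le> norm (cgrad (bergman_projection \<alpha> g) z)"
      by (rule Finite_Cartesian_Product.norm_nth_le)
    finally have "(1 - x) * (p * (?I (p + 1) - ?I p)) \<le> (1 - (norm z)\<^sup>2) * norm (cgrad (bergman_projection \<alpha> g) z)"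
      unfolding nz using x by (intro mult_left_mono) auto
    then have "ereal ((1 - x) * (p * (?I (p + 1) - ?I p))) \<le> bloch_seminorm (bergman_projection \<alpha> g)"
      unfolding bloch_seminorm_def by (intro SUP_upper2[OF z]) simp
    also have "(1 - x) * (p * (?I (p + 1) - ?I p)) = p * ((1 - x) * ?I (p + 1) - (1 - x) * ?I p)"
      by (simp add: algebra_simps)
    finally show ?thesis unfolding I1 I2 .
  qed
  ultimately show ?thesis by blast
qed

text \<open>The upper bound holds for each admissible \<open>g\<close>. The lower bound is a limit:
  \<open>g\<close> varies with \<open>x\<close>, and every one of its values stays below the
  supremum.\<close>

lemma bloch_op_seminorm_bergman_projection:
  "bloch_op_seminorm (bergman_projection \<alpha> :: (complex ^ 'n \<Rightarrow> complex) \<Rightarrow> complex ^ 'n \<Rightarrow> complex) = ereal (p * L)"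
proof (rule antisym)
  let ?S = "bloch_op_seminorm (bergman_projection \<alpha> :: (complex ^ 'n \<Rightarrow> complex) \<Rightarrow> complex ^ 'n \<Rightarrow> complex)"
  show "?S \<le> ereal (p * L)"
    unfolding bloch_op_seminorm_def
  proof (rule SUP_least)
    fix g :: "complex ^ 'n \<Rightarrow> complex" assume "g \<in> {g \<in> Linf. Linf_norm g \<le> 1}"
    then show "bloch_seminorm (bergman_projection \<alpha> g) \<le> ereal (p * L)"
      using bloch_seminorm_bergman_projection_le(1)[of g 1] by (auto simp: Linf_def one_ereal_def)
  qed
  let ?u = "\<lambda>k. (pochhammer ((p + 1) / 2) k)\<^sup>2 / (fact k * pochhammer p k)"
  let ?v = "\<lambda>k. (pochhammer (p / 2) k)\<^sup>2 / (fact k * pochhammer p k)"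
  have "?u \<longlonglongrightarrow> L" "?v \<longlonglongrightarrow> 0"
    using pochhammer_ratio_LIMSEQ(1)[of "(p + 1) / 2" p] pochhammer_ratio_LIMSEQ(2)[of "p / 2" p] exponent_pos
    by (auto simp: L_def)
  \<comment> \<open>By the Abelian theorem the first mean tends to \<open>L\<close> and the
    subtracted one to 0.\<close>
  then have "((\<lambda>x. p * ((1 - x) * (\<Sum>k. ?u k * x ^ k) - (1 - x) * (\<Sum>k. ?v k * x ^ k))) \<longlongrightarrow> p * (L - 0)) (at_left 1)"
    by (intro tendsto_mult_left tendsto_diff abel_mean_tendsto)
  then have "((\<lambda>x. ereal (p * ((1 - x) * (\<Sum>k. ?u k * x ^ k) - (1 - x) * (\<Sum>k. ?v k * x ^ k)))) \<longlongrightarrow> ereal (p * L)) (at_left 1)"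
    by simp
  moreover have "\<forall>\<^sub>F x in at_left 1. ereal (p * ((1 - x) * (\<Sum>k. ?u k * x ^ k) - (1 - x) * (\<Sum>k. ?v k * x ^ k))) \<le> ?S"
  proof (rule eventually_at_leftI[of 0])
    fix x :: real assume "x \<in> {0<..<1}"
    then obtain g :: "complex ^ 'n \<Rightarrow> complex" where "g \<in> Linf" "Linf_norm g \<le> 1"
      "ereal (p * ((1 - x) * (\<Sum>k. ?u k * x ^ k) - (1 - x) * (\<Sum>k. ?v k * x ^ k))) \<le> bloch_seminorm (bergman_projection \<alpha> g)"
      using bloch_seminorm_bergman_projection_ge[of x] by auto
    then show "ereal (p * ((1 - x) * (\<Sum>k. ?u k * x ^ k) - (1 - x) * (\<Sum>k. ?v k * x ^ k))) \<le> ?S"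
      unfolding bloch_op_seminorm_def by (intro SUP_upper2[of g]) auto
  qed simp
  ultimately show "ereal (p * L) \<le> ?S"
    by (rule tendsto_upperbound) simp
qed

end

theorem theorem1p2:
  fixes \<alpha> :: real
  assumes "\<alpha> > -1"
  shows "bergman_projection \<alpha> \<in> (Linf :: (complex ^ 'n::finite \<Rightarrow> complex) set) \<rightarrow> bloch_space \<and>
    bloch_op_seminorm
        (bergman_projection \<alpha> :: (complex ^ 'n \<Rightarrow> complex) \<Rightarrow> complex ^ 'n \<Rightarrow> complex) =
      ereal (Gamma (2 + real CARD('n) + \<alpha>) / (Gamma ((2 + real CARD('n) + \<alpha>) / 2))\<^sup>2)"
proof
  show "bergman_projection \<alpha> \<in> (Linf :: (complex ^ 'n \<Rightarrow> complex) set) \<rightarrow> bloch_space"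
  proof
    fix g :: "complex ^ 'n \<Rightarrow> complex" assume g: "g \<in> Linf"
    \<comment> \<open>The maximum with 0 supplies \<open>M \<ge> 0\<close> directly, whatever the
      extended real value of \<open>Linf_norm g\<close>.\<close>
    define M where "M = max (real_of_ereal (Linf_norm g)) 0"
    have M: "Linf_norm g \<le> ereal M" "M \<ge> 0"
      using g by (cases "Linf_norm g"; simp add: M_def Linf_def)+
    have "g \<in> borel_measurable ball_measure" using g by (simp add: Linf_def)
    from bloch_seminorm_bergman_projection_le[OF assms this M]
    show "bergman_projection \<alpha> g \<in> bloch_space"
      by (auto simp: bloch_space_def intro: le_less_trans)
  qed
  define p where "p = real CARD('n) + 1 + \<alpha>"
  have "p > 0" using assms by (simp add: p_def add_nonneg_pos)
  \<comment> \<open>The functional equation absorbs the factor \<open>p\<close> from differentiating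
    the kernel into Gamma.\<close>
  then have G: "Gamma (p + 1) = p * Gamma p"
    by (intro Gamma_plus1) (auto elim!: nonpos_Ints_cases)
  have e: "2 + real CARD('n) + \<alpha> = p + 1"
    by (simp add: p_def)
  show "bloch_op_seminorm
        (bergman_projection \<alpha> :: (complex ^ 'n \<Rightarrow> complex) \<Rightarrow> complex ^ 'n \<Rightarrow> complex) =
      ereal (Gamma (2 + real CARD('n) + \<alpha>) / (Gamma ((2 + real CARD('n) + \<alpha>) / 2))\<^sup>2)"
    unfolding e G using bloch_op_seminorm_bergman_projection[OF assms, where 'n='n] by (simp add: p_def[symmetric])
qed

end
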